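(* In the setting described in the context, suppose that the combination matrix $C$ is primitive and left-stochastic and that the vector of weights $\tau$ defining the global problem is the Perron eigenvector of $C$, i.e. $C\tau=\tau$ and $\tau^\top\mathbb{1}_N=1$. For step-sizes $\mu>0$ sufficiently small to ensure mean-square stability, let $$\tilde\alpha_\infty=\lim_{i\to\infty}\mathbb{E}\tilde{\boldsymbol\alpha}_i=\Big(I_{2MN}-\mathcal{C}^\top(I_{2MN}-\mu\mathcal{R})\Big)^{-1}\mu\,\mathcal{C}^\top(\mathcal{G}\alpha^o+g)$$ be the steady-state bias. Then $$\tilde\alpha_\infty=O(\mu)\qquad(\mu\to0),$$ that is, there exist constants $K,\mu_1>0$ independent of $\mu$ with $\|\tilde\alpha_\infty\|\le K\mu$ for all $0<\mu<\mu_1$.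
   Context: **MDP and features.** $\mathbb{S}=\{1,\dots,S\}$ is a finite state set, $\mathbb{A}$ a finite action set, $\mathcal{P}(s'|s,a)$ a transition kernel, $r(s,a,s')\in\mathbb{R}$ a reward function, $\gamma\in(0,1)$. $\pi(a|s)$ is a target policy, $P^\pi$ is the $S\times S$ matrix with entries $p^\pi_{ss'}=\sum_a\mathcal{P}(s'|s,a)\pi(a|s)$, and $r^\pi\in\mathbb{R}^S$ has entries $r^\pi(s)=\sum_a\pi(a|s)\sum_{s'}\mathcal{P}(s'|s,a)r(s,a,s')$. Each state $s$ has a feature vector $x_s\in\mathbb{R}^M$; $X\in\mathbb{R}^{S\times M}$ has rows $x_s^\top$ and has full column rank. $X$ and $r^\pi$ are bounded. **Agents.** There are $N$ agents. Agent $k$ follows a behavior policy $\phi_k(a|s)$ with stationary state distribution $d^{\phi_k}$ (entries may be zero); $D^{\phi_k}=\mathrm{diag}\{d^{\phi_k}\}$. The importance weight is $\xi_k(a,s)=\pi(a|s)/\phi_k(a|s)$ (implicitly $\phi_k(a|s)>0$ whenever $d^{\phi_k}(s)>0$ and $\pi(a|s)>0$). The data of agent $k$ are i.i.d. over time $i$: $\boldsymbol s_k(i)\sim d^{\phi_k}$, $\boldsymbol a_k(i)\sim\phi_k(\cdot|\boldsymbol s_k(i))$, next state $\boldsymbol s'\sim\mathcal{P}(\cdot|\boldsymbol s_k(i),\boldsymbol a_k(i))$; agents are independent. Write $\boldsymbol x_{k,i}=x_{\boldsymbol s_k(i)}$, $\boldsymbol\delta_{k,i+1}=x_{\boldsymbol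 s_k(i)}-\gamma x_{\boldsymbol s'}$, $\boldsymbol\xi_k(i)=\xi_k(\boldsymbol a_k(i),\boldsymbol s_k(i))$, $\boldsymbol r_k(i+1)=r(\boldsymbol s_k(i),\boldsymbol a_k(i),\boldsymbol s')$. **Network and global problem.** $C=[c_{lk}]$ is an $N\times N$ matrix with $c_{lk}\ge0$; left-stochastic means $\sum_l c_{lk}=1$ for each $k$; primitive means some power of $C$ has all entries positive. $\tau=(\tau_1,\dots,\tau_N)^\top$ is a vector of non-negative weights summing to one. Put $D^{\overline\phi}=\sum_k\tau_kD^{\phi_k}$, assumed positive definite. The global problem is to minimize over $\theta\in\mathbb{R}^M$ the cost $\sum_k\tau_k\big(\tfrac12\theta^\top X^\top D^{\phi_k}X\theta-\theta^\top X^\top D^{\phi_k}r^\pi\big)$ subject to $\sum_k\tau_k\big(X^\top D^{\phi_k}(I_S-\gamma P^\pi)X\big)^\top\theta=0$; its Lagrangian has the saddle point $\alpha^o=\mathrm{col}\{0_M,w^o\}$ with $w^o=\big(X^\top D^{\overline\phi}(I_S-\gamma P^\pi)X\big)^{-1}X^\top D^{\overline\phi}r^\pi$, the matrix $X^\top D^{\overline\phi}(I_S-\gamma P^\pi)X$ being invertible. **Algorithm (diffusion GTD).** Fix $\eta>0$ and step-size $\mu>0$. With $$\boldsymbol G_{k,i+1}=\begin{bmatrix}\eta\boldsymbol x_{k,i}\boldsymbol x_{k,i}^\top\boldsymbol\xi_k(i)&\eta\boldsymbol x_{k,i}\boldsymbol\delta_{k,i+1}^\top\boldsymbol\xi_k(i)\\-\boldsymbol\delta_{k,i+1}\boldsymbol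 x_{k,i}^\top\boldsymbol\xi_k(i)&0_{M\times M}\end{bmatrix},\quad \boldsymbol g_{k,i+1}=\begin{bmatrix}-\eta\boldsymbol x_{k,i}\boldsymbol\xi_k(i)\boldsymbol r_k(i+1)\\0_M\end{bmatrix},$$ each agent updates $\boldsymbol\alpha_{k,i}\in\mathbb{R}^{2M}$ by $\boldsymbol\psi_{k,i+1}=\boldsymbol\alpha_{k,i}-\mu(\boldsymbol G_{k,i+1}\boldsymbol\alpha_{k,i}+\boldsymbol g_{k,i+1})$, $\boldsymbol\alpha_{k,i+1}=\sum_l c_{lk}\boldsymbol\psi_{l,i+1}$, from deterministic initial values. Errors: $\tilde{\boldsymbol\alpha}_{k,i}=\alpha^o-\boldsymbol\alpha_{k,i}$, $\tilde{\boldsymbol\alpha}_i=\mathrm{col}\{\tilde{\boldsymbol\alpha}_{1,i},\dots,\tilde{\boldsymbol\alpha}_{N,i}\}\in\mathbb{R}^{2MN}$. **Mean quantities.** $$G_k=\mathbb{E}\boldsymbol G_{k,i}=\begin{bmatrix}\eta X^\top D^{\phi_k}X&\eta X^\top D^{\phi_k}(I_S-\gamma P^\pi)X\\-X^\top(I_S-\gamma P^\pi)^\top D^{\phi_k}X&0\end{bmatrix},\quad g_k=\mathbb{E}\boldsymbol g_{k,i}=\begin{bmatrix}-\eta X^\top D^{\phi_k}r^\pi\\0_M\end{bmatrix},$$ $\mathcal{C}=C\otimes I_{2M}$, $\mathcal{R}=\mathrm{diag}\{G_1,\dots,G_N\}$ (block diagonal), $\mathcal{G}=\mathrm{col}\{G_1,\dots,G_N\}$,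 $g=\mathrm{col}\{g_1,\dots,g_N\}$. The mean error obeys $\mathbb{E}\tilde{\boldsymbol\alpha}_{i+1}=\mathcal{C}^\top(I-\mu\mathcal{R})\mathbb{E}\tilde{\boldsymbol\alpha}_i+\mu\mathcal{C}^\top(\mathcal{G}\alpha^o+g)$. **Mean-square stability** at step-size $\mu$ means that both $\mathcal{C}^\top(I_{2MN}-\mu\mathcal{R})$ and $$\mathcal F=\big((I-\mu\mathcal R^\top)\mathcal C\big)\otimes\big((I-\mu\mathcal R^\top)\mathcal C\big)+\mu^2\,\mathbb{E}\Big[\big((\boldsymbol{\mathcal R}_i^\top-\mathcal R^\top)\mathcal C\big)\otimes\big((\boldsymbol{\mathcal R}_i^\top-\mathcal R^\top)\mathcal C\big)\Big],\quad \boldsymbol{\mathcal R}_i=\mathrm{diag}\{\boldsymbol G_{1,i},\dots,\boldsymbol G_{N,i}\},$$ have spectral radius less than one; it holds for all sufficiently small $\mu>0$. *)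

theory Defs
  imports "HOL-Analysis.Analysis" "HOL-Probability.Probability"
begin

section \<open>Matrix notions\<close>

definition diag_matrix :: "('p \<Rightarrow> real) \<Rightarrow> real^'p^'p" where
  "diag_matrix d = (\<chi> i j. if i = j then d i else 0)"

definition outer_product :: "real^'q \<Rightarrow> real^'p \<Rightarrow> real^'p^'q" where
  "outer_product u v = (\<chi> i j. u $ i * v $ j)"

definition vec_append :: "real^'p \<Rightarrow> real^'q \<Rightarrow> real^('p + 'q)" where
  "vec_append u v = (\<chi> i. case i of Inl a \<Rightarrow> u $ a | Inr b \<Rightarrow> v $ b)"

definition four_block ::
  "real^'p^'p \<Rightarrow> real^'q^'p \<Rightarrow> real^'p^'q \<Rightarrow> real^'q^'q \<Rightarrow> real^('p + 'q)^('p + 'q)" where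
  "four_block A B C D = (\<chi> i j. case (i, j) of
      (Inl a, Inl b) \<Rightarrow> A $ a $ b | (Inl a, Inr b) \<Rightarrow> B $ a $ b
    | (Inr a, Inl b) \<Rightarrow> C $ a $ b | (Inr a, Inr b) \<Rightarrow> D $ a $ b)"

definition kronecker :: "real^'p^'q \<Rightarrow> real^'r^'t \<Rightarrow> real^('p \<times> 'r)^('q \<times> 't)" where
  "kronecker A B = (\<chi> i j. A $ fst i $ fst j * B $ snd i $ snd j)"

definition block_diag :: "('n::finite \<Rightarrow> real^'p^'p) \<Rightarrow> real^('n \<times> 'p)^('n \<times> 'p)" where
  "block_diag G = (\<chi> i j. if fst i = fst j then G (fst i) $ snd i $ snd j else 0)"

text \<open>Stacking of one block per agent; for matrix blocks it stacks the rows.\<close>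

definition col :: "('n::finite \<Rightarrow> 'a^'p) \<Rightarrow> 'a^('n \<times> 'p)" where
  "col v = (\<chi> i. v (fst i) $ snd i)"

definition positive_definite :: "real^'p^'p \<Rightarrow> bool" where
  "positive_definite A \<longleftrightarrow> transpose A = A \<and> (\<forall>v. v \<noteq> 0 \<longrightarrow> v \<bullet> (A *v v) > 0)"

text \<open>Eigenvalues of a real matrix are taken over the complex numbers.\<close>

definition spectrum_of :: "real^'p^'p \<Rightarrow> complex set" where
  "spectrum_of A = {z. \<exists>v. v \<noteq> 0 \<and> map_matrix complex_of_real A *v v = z *s v}"

definition spectral_rad :: "real^'p^'p \<Rightarrow> real" where
  "spectral_rad A = Sup (cmod ` spectrum_of A)"

definition left_stochastic :: "real^'n^'n \<Rightarrow> bool" where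
  "left_stochastic C \<longleftrightarrow> (\<forall>l k. C $ l $ k \<ge> 0) \<and> (\<forall>k. (\<Sum>l\<in>UNIV. C $ l $ k) = 1)"

definition primitive_matrix :: "real^'n^'n \<Rightarrow> bool" where
  "primitive_matrix C \<longleftrightarrow> (\<exists>p>0. \<forall>l k. (((**) C ^^ p) (mat 1)) $ l $ k > 0)"

definition perron_eigenvector :: "real^'n^'n \<Rightarrow> real^'n \<Rightarrow> bool" where
  "perron_eigenvector C t \<longleftrightarrow> C *v t = t \<and> (\<Sum>k\<in>UNIV. t $ k) = 1"


section \<open>The multi-agent policy evaluation problem\<close>

text \<open>
  States \<open>'s\<close>, actions \<open>'a\<close>, agents \<open>'n\<close>, features \<open>'m\<close>.  Row \<open>s\<close> of
  \<open>feat\<close> is the feature vector of state \<open>s\<close>; \<open>stat_dist k\<close> is the stationary state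
  distribution under the behavior policy of agent \<open>k\<close>; \<open>comb $ l $ k\<close> is the weight that
  agent \<open>k\<close> gives to agent \<open>l\<close>.
\<close>

record ('s, 'a, 'n, 'm) gtd_problem =
  trans_prob :: "'s \<Rightarrow> 'a \<Rightarrow> 's pmf"
  reward :: "'s \<Rightarrow> 'a \<Rightarrow> 's \<Rightarrow> real"
  discount :: real
  target :: "'s \<Rightarrow> 'a pmf"
  feat :: "real^'m^'s"
  behavior :: "'n \<Rightarrow> 's \<Rightarrow> 'a pmf"
  stat_dist :: "'n \<Rightarrow> 's pmf"
  comb :: "real^'n^'n"
  weights :: "real^'n"
  eta :: real

definition trans_matrix :: "('s::finite, 'a::finite, 'n::finite, 'm::finite) gtd_problem \<Rightarrow> real^'s^'s" where
  "trans_matrix pr = (\<chi> s s'. \<Sum>a\<in>UNIV. pmf (trans_prob pr s a) s' * pmf (target pr s) a)"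

definition reward_vec :: "('s::finite, 'a::finite, 'n::finite, 'm::finite) gtd_problem \<Rightarrow> real^'s" where
  "reward_vec pr = (\<chi> s. \<Sum>a\<in>UNIV. pmf (target pr s) a *
     (\<Sum>s'\<in>UNIV. pmf (trans_prob pr s a) s' * reward pr s a s'))"

definition state_weighting ::
  "('s::finite, 'a::finite, 'n::finite, 'm::finite) gtd_problem \<Rightarrow> 'n \<Rightarrow> real^'s^'s" where
  "state_weighting pr k = diag_matrix (pmf (stat_dist pr k))"

definition mean_state_weighting ::
  "('s::finite, 'a::finite, 'n::finite, 'm::finite) gtd_problem \<Rightarrow> real^'s^'s" where
  "mean_state_weighting pr = (\<Sum>k\<in>UNIV. weights pr $ k *\<^sub>R state_weighting pr k)"

text \<open>The matrices \<open>X\<^sup>T D X\<close>, \<open>X\<^sup>T D (I - \<gamma> P) X\<close> and the vector \<open>X\<^sup>T D r\<close> for a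
  state weighting \<open>D\<close>.\<close>

definition gram :: "('s::finite, 'a::finite, 'n::finite, 'm::finite) gtd_problem \<Rightarrow> real^'s^'s \<Rightarrow> real^'m^'m" where
  "gram pr D = transpose (feat pr) ** D ** feat pr"

definition td_matrix :: "('s::finite, 'a::finite, 'n::finite, 'm::finite) gtd_problem \<Rightarrow> real^'s^'s \<Rightarrow> real^'m^'m" where
  "td_matrix pr D =
     transpose (feat pr) ** D ** (mat 1 - discount pr *\<^sub>R trans_matrix pr) ** feat pr"

definition td_vec :: "('s::finite, 'a::finite, 'n::finite, 'm::finite) gtd_problem \<Rightarrow> real^'s^'s \<Rightarrow> real^'m" where
  "td_vec pr D = transpose (feat pr) *v (D *v reward_vec pr)"

text \<open>\<open>alpha_opt\<close> is the saddle point of the Lagrangian of the problem of minimizing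
  \<open>\<Sum>k. \<tau>\<^sub>k (1/2 \<theta>\<^sup>T X\<^sup>T D\<^sub>k X \<theta> - \<theta>\<^sup>T X\<^sup>T D\<^sub>k r)\<close> subject to
  \<open>(\<Sum>k. \<tau>\<^sub>k X\<^sup>T D\<^sub>k (I - \<gamma> P) X)\<^sup>T \<theta> = 0\<close>: its primal part is \<open>0\<close>, its dual part \<open>w_opt\<close>.\<close>

definition w_opt :: "('s::finite, 'a::finite, 'n::finite, 'm::finite) gtd_problem \<Rightarrow> real^'m" where
  "w_opt pr = matrix_inv (td_matrix pr (mean_state_weighting pr)) *v td_vec pr (mean_state_weighting pr)"

definition alpha_opt :: "('s::finite, 'a::finite, 'n::finite, 'm::finite) gtd_problem \<Rightarrow> real^('m + 'm)" where
  "alpha_opt pr = vec_append 0 (w_opt pr)"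

text \<open>Law of one data triple (state, action, next state) of agent \<open>k\<close>.\<close>

definition sample_pmf ::
  "('s::finite, 'a::finite, 'n::finite, 'm::finite) gtd_problem \<Rightarrow> 'n \<Rightarrow> ('s \<times> 'a \<times> 's) pmf" where
  "sample_pmf pr k = bind_pmf (stat_dist pr k) (\<lambda>s. bind_pmf (behavior pr k s)
     (\<lambda>a. map_pmf (\<lambda>s'. (s, a, s')) (trans_prob pr s a)))"

locale gtd_setting =
  fixes pr :: "('s::finite, 'a::finite, 'n::finite, 'm::finite) gtd_problem"
  assumes discount_range: "0 < discount pr" "discount pr < 1"
    and eta_pos: "0 < eta pr"
    and full_column_rank: "rank (feat pr) = CARD('m)"
    and stationary: "\<And>k. bind_pmf (stat_dist pr k)
          (\<lambda>s. bind_pmf (behavior pr k s) (trans_prob pr s)) = stat_dist pr k"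
    and coverage: "\<And>k s a. pmf (stat_dist pr k) s > 0 \<Longrightarrow> pmf (target pr s) a > 0 \<Longrightarrow>
          pmf (behavior pr k s) a > 0"
    and weights_nonneg: "\<And>k. weights pr $ k \<ge> 0"
    and weights_sum: "(\<Sum>k\<in>UNIV. weights pr $ k) = 1"
    and mean_state_weighting_pos: "positive_definite (mean_state_weighting pr)"
    and td_matrix_invertible: "invertible (td_matrix pr (mean_state_weighting pr))"

text \<open>\<open>Z k i\<close> is the triple (state, action, next state) observed by agent \<open>k\<close> at time \<open>i\<close>.
  Independence is over all pairs of agent and time.\<close>

locale gtd_data = gtd_setting pr + prob_space \<Omega>
  for pr :: "('s::finite, 'a::finite, 'n::finite, 'm::finite) gtd_problem" and \<Omega> :: "'w measure" +
  fixes Z :: "'n \<Rightarrow> nat \<Rightarrow> 'w \<Rightarrow> 's \<times> 'a \<times> 's"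
  assumes data_indep: "indep_vars (\<lambda>_. count_space UNIV) (\<lambda>(k, i). Z k i) UNIV"
    and data_distr: "\<And>k i. distr \<Omega> (count_space UNIV) (Z k i) = measure_pmf (sample_pmf pr k)"


section \<open>Diffusion GTD\<close>

definition importance ::
  "('s::finite, 'a::finite, 'n::finite, 'm::finite) gtd_problem \<Rightarrow> 'n \<Rightarrow> 'a \<Rightarrow> 's \<Rightarrow> real" where
  "importance pr k a s = pmf (target pr s) a / pmf (behavior pr k s) a"

definition G_sample :: "('s::finite, 'a::finite, 'n::finite, 'm::finite) gtd_problem \<Rightarrow> 'n \<Rightarrow>
    's \<times> 'a \<times> 's \<Rightarrow> real^('m + 'm)^('m + 'm)" where
  "G_sample pr k = (\<lambda>(s, a, s').
     let x = feat pr $ s; \<delta> = x - discount pr *\<^sub>R feat pr $ s'; \<xi> = importance pr k a s in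
     four_block ((eta pr * \<xi>) *\<^sub>R outer_product x x) ((eta pr * \<xi>) *\<^sub>R outer_product x \<delta>)
                (- \<xi> *\<^sub>R outer_product \<delta> x) 0)"

definition g_sample :: "('s::finite, 'a::finite, 'n::finite, 'm::finite) gtd_problem \<Rightarrow> 'n \<Rightarrow>
    's \<times> 'a \<times> 's \<Rightarrow> real^('m + 'm)" where
  "g_sample pr k = (\<lambda>(s, a, s').
     vec_append (- (eta pr * importance pr k a s * reward pr s a s') *\<^sub>R feat pr $ s) 0)"

text \<open>\<open>z l i\<close> is the data triple of agent \<open>l\<close> at time \<open>i\<close>, \<open>\<alpha>0\<close> holds the initial values.\<close>

primrec gtd_iterate :: "('s::finite, 'a::finite, 'n::finite, 'm::finite) gtd_problem \<Rightarrow> real \<Rightarrow>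
    ('n \<Rightarrow> real^('m + 'm)) \<Rightarrow> ('n \<Rightarrow> nat \<Rightarrow> 's \<times> 'a \<times> 's) \<Rightarrow> nat \<Rightarrow> 'n \<Rightarrow> real^('m + 'm)" where
  "gtd_iterate pr \<mu> \<alpha>0 z 0 = \<alpha>0"
| "gtd_iterate pr \<mu> \<alpha>0 z (Suc i) = (\<lambda>k. \<Sum>l\<in>UNIV. comb pr $ l $ k *\<^sub>R
     (let \<alpha> = gtd_iterate pr \<mu> \<alpha>0 z i l in
      \<alpha> - \<mu> *\<^sub>R (G_sample pr l (z l i) *v \<alpha> + g_sample pr l (z l i))))"

definition network_error :: "('s::finite, 'a::finite, 'n::finite, 'm::finite) gtd_problem \<Rightarrow> real \<Rightarrow>
    ('n \<Rightarrow> real^('m + 'm)) \<Rightarrow> ('n \<Rightarrow> nat \<Rightarrow> 's \<times> 'a \<times> 's) \<Rightarrow> nat \<Rightarrow> real^('n \<times> ('m + 'm))" where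
  "network_error pr \<mu> \<alpha>0 z i = col (\<lambda>k. alpha_opt pr - gtd_iterate pr \<mu> \<alpha>0 z i k)"

definition mean_network_error :: "('s::finite, 'a::finite, 'n::finite, 'm::finite) gtd_problem \<Rightarrow>
    'w measure \<Rightarrow> ('n \<Rightarrow> nat \<Rightarrow> 'w \<Rightarrow> 's \<times> 'a \<times> 's) \<Rightarrow> ('n \<Rightarrow> real^('m + 'm)) \<Rightarrow> real \<Rightarrow> nat \<Rightarrow>
    real^('n \<times> ('m + 'm))" where
  "mean_network_error pr \<Omega> Z \<alpha>0 \<mu> i =
     (\<integral>\<omega>. network_error pr \<mu> \<alpha>0 (\<lambda>l j. Z l j \<omega>) i \<partial>\<Omega>)"


section \<open>Mean quantities, mean-square stability and bias\<close>

definition G_mean :: "('s::finite, 'a::finite, 'n::finite, 'm::finite) gtd_problem \<Rightarrow> 'n \<Rightarrow>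
    real^('m + 'm)^('m + 'm)" where
  "G_mean pr k =
     (let D = state_weighting pr k in
      four_block (eta pr *\<^sub>R gram pr D) (eta pr *\<^sub>R td_matrix pr D)
                 (- transpose (td_matrix pr D)) 0)"

definition g_mean :: "('s::finite, 'a::finite, 'n::finite, 'm::finite) gtd_problem \<Rightarrow> 'n \<Rightarrow>
    real^('m + 'm)" where
  "g_mean pr k = vec_append (- eta pr *\<^sub>R td_vec pr (state_weighting pr k)) 0"

definition network_comb :: "('s::finite, 'a::finite, 'n::finite, 'm::finite) gtd_problem \<Rightarrow>
    real^('n \<times> ('m + 'm))^('n \<times> ('m + 'm))" where
  "network_comb pr = kronecker (comb pr) (mat 1)"

definition R_mean :: "('s::finite, 'a::finite, 'n::finite, 'm::finite) gtd_problem \<Rightarrow>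
    real^('n \<times> ('m + 'm))^('n \<times> ('m + 'm))" where
  "R_mean pr = block_diag (G_mean pr)"

definition mean_error_matrix :: "('s::finite, 'a::finite, 'n::finite, 'm::finite) gtd_problem \<Rightarrow> real \<Rightarrow>
    real^('n \<times> ('m + 'm))^('n \<times> ('m + 'm))" where
  "mean_error_matrix pr \<mu> = transpose (network_comb pr) ** (mat 1 - \<mu> *\<^sub>R R_mean pr)"

text \<open>\<open>G_mean\<close> and \<open>g_mean\<close> are the expectations of \<open>G_sample\<close> and \<open>g_sample\<close> under
  \<open>sample_pmf\<close>; this uses that the target policy is covered by the behavior policies.
  The expectation below is over the data of all agents at one time instant; the agents are
  independent, so their joint law is a product.\<close>

definition mean_square_matrix :: "('s::finite, 'a::finite, 'n::finite, 'm::finite) gtd_problem \<Rightarrow> real \<Rightarrow>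
    real^(('n \<times> ('m + 'm)) \<times> ('n \<times> ('m + 'm)))^(('n \<times> ('m + 'm)) \<times> ('n \<times> ('m + 'm)))" where
  "mean_square_matrix pr \<mu> =
     (let A = (mat 1 - \<mu> *\<^sub>R transpose (R_mean pr)) ** network_comb pr;
          N = (\<lambda>z. (transpose (block_diag (\<lambda>k. G_sample pr k (z k))) - transpose (R_mean pr))
                   ** network_comb pr)
      in kronecker A A + \<mu>\<^sup>2 *\<^sub>R
           measure_pmf.expectation (Pi_pmf UNIV undefined (sample_pmf pr)) (\<lambda>z. kronecker (N z) (N z)))"

definition mean_square_stable ::
  "('s::finite, 'a::finite, 'n::finite, 'm::finite) gtd_problem \<Rightarrow> real \<Rightarrow> bool" where
  "mean_square_stable pr \<mu> \<longleftrightarrow>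
     spectral_rad (mean_error_matrix pr \<mu>) < 1 \<and> spectral_rad (mean_square_matrix pr \<mu>) < 1"

definition bias_system :: "('s::finite, 'a::finite, 'n::finite, 'm::finite) gtd_problem \<Rightarrow> real \<Rightarrow>
    real^('n \<times> ('m + 'm))^('n \<times> ('m + 'm))" where
  "bias_system pr \<mu> = mat 1 - mean_error_matrix pr \<mu>"

definition steady_state_bias :: "('s::finite, 'a::finite, 'n::finite, 'm::finite) gtd_problem \<Rightarrow> real \<Rightarrow>
    real^('n \<times> ('m + 'm))" where
  "steady_state_bias pr \<mu> = matrix_inv (bias_system pr \<mu>) *v
     (\<mu> *\<^sub>R (transpose (network_comb pr) *v (col (G_mean pr) *v alpha_opt pr + col (g_mean pr))))"

end

theory Submission
  imports Defs "HOL-Computational_Algebra.Fundamental_Theorem_Algebra"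
begin

text \<open>
  Write \<open>P = \<C>\<^sup>T\<close> and let \<open>T x = \<Sum>k. \<tau>\<^sub>k x\<^sub>k\<close>. The bias solves \<open>x = P (x - \<mu> \<R> x + \<mu> b)\<close> with
  \<open>b = \<G> \<alpha>\<^sup>o + g\<close>. Since \<open>C \<tau> = \<tau>\<close>, \<open>T P = T\<close>; since \<open>\<alpha>\<^sup>o\<close> is the saddle point for the weights \<open>\<tau>\<close>,
  \<open>T b = 0\<close>. Applying \<open>T\<close> therefore gives \<open>T \<R> x = 0\<close>, while \<open>x - P x = \<mu> P (b - \<R> x)\<close>. The linear map
  \<open>x \<mapsto> (x - P x, T \<R> x)\<close> is injective: a fixed point of \<open>P\<close> has equal blocks \<open>y\<close> because \<open>C\<close> is
  primitive, and then \<open>T \<R> x = (\<Sum>k. \<tau>\<^sub>k G\<^sub>k) y\<close>, where the matrix is invertible. Hence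
  \<open>norm x \<le> const * \<mu> * (norm b + norm x)\<close>.

  The mean error converges to the bias because a fresh sample is independent of the current iterate, so
  that the mean error obeys an affine recursion, and the powers of a matrix of spectral radius less
  than one tend to zero.
\<close>

section \<open>Powers of a matrix of spectral radius less than one\<close>

definition poly_action :: "complex^'p^'p \<Rightarrow> complex poly \<Rightarrow> complex^'p \<Rightarrow> complex^'p" where
  "poly_action A p v = (\<Sum>i\<le>degree p. coeff p i *s (((*v) A ^^ i) v))"

text \<open>Coefficients above the degree vanish. A common summation bound lets polynomials of
  different degree be compared term by term.\<close>

lemma poly_action_extend:
  "degree p \<le> n \<Longrightarrow> poly_action A p v = (\<Sum>i\<le>n. coeff p i *s (((*v) A ^^ i) v))"
  unfolding poly_action_def
  by (rule sum.mono_neutral_left) (auto simp: coeff_eq_0)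

lemma poly_action_pCons_0: "poly_action A (pCons 0 p) v = A *v poly_action A p v"
proof -
  have "poly_action A (pCons 0 p) v = (\<Sum>i\<le>Suc (degree p). coeff (pCons 0 p) i *s (((*v) A ^^ i) v))"
    by (rule poly_action_extend) (simp add: degree_pCons_le)
  also have "\<dots> = (\<Sum>i\<le>degree p. coeff p i *s (A *v ((*v) A ^^ i) v))"
    by (subst sum.atMost_Suc_shift) simp
  also have "\<dots> = A *v poly_action A p v"
    by (simp only: poly_action_def vec.scale[symmetric] vec.sum)
  finally show ?thesis .
qed

text \<open>Multiplying by \<open>X - z\<close> shifts the coefficients and subtracts
  \<open>z\<close> times the original, which acts as \<open>A - z\<close>.\<close>

lemma poly_action_linear_factor:
  "poly_action A ([:- z, 1:] * q) v = A *v poly_action A q v - z *s poly_action A q v"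
proof -
  have e: "[:- z, 1:] * q = pCons 0 q - smult z q" by (simp add: algebra_simps)
  define n where "n = max (degree (pCons 0 q)) (degree q)"
  have dn: "degree (pCons 0 q) \<le> n" "degree q \<le> n" unfolding n_def by auto
  have "poly_action A (pCons 0 q - smult z q) v =
      (\<Sum>i\<le>n. coeff (pCons 0 q - smult z q) i *s (((*v) A ^^ i) v))"
    by (rule poly_action_extend) (auto simp: n_def intro!: degree_diff_le degree_smult_le[THEN order_trans])
  also have "\<dots> = (\<Sum>i\<le>n. coeff (pCons 0 q) i *s (((*v) A ^^ i) v)) - z *s (\<Sum>i\<le>n. coeff q i *s (((*v) A ^^ i) v))"
    by (simp only: coeff_diff coeff_smult vec.scale_left_diff_distrib sum_subtractf
        vec.scale_sum_right vec.scale_scale)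
  also have "\<dots> = A *v poly_action A q v - z *s poly_action A q v"
    by (simp only: poly_action_extend[OF dn(1), symmetric] poly_action_extend[OF dn(2), symmetric]
        poly_action_pCons_0)
  finally show ?thesis unfolding e .
qed

lemma funpow_matrix_diff_scale:
  "((*v) A ^^ i) (A *v v - z *s v) = A *v ((*v) A ^^ i) v - z *s (((*v) A ^^ i) v)"
  for A :: "complex^'p^'p"
  by (induction i) (auto simp: vec.diff vec.scale)

text \<open>Polynomials in \<open>A\<close> commute with \<open>A - z\<close>, so a cofactor
  \<open>q\<close> that sends \<open>v\<close> into the kernel of \<open>A - z\<close> annihilates
  \<open>A v - z v\<close>.\<close>

lemma poly_action_commute:
  "poly_action A q (A *v v - z *s v) = A *v poly_action A q v - z *s poly_action A q v"
proof -
  have "poly_action A q (A *v v - z *s v) =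
      (\<Sum>i\<le>degree q. A *v (coeff q i *s ((*v) A ^^ i) v) - z *s (coeff q i *s ((*v) A ^^ i) v))"
    unfolding poly_action_def funpow_matrix_diff_scale
    by (intro sum.cong refl) (simp add: vec.scale vec.scale_right_diff_distrib mult.commute)
  then show ?thesis
    by (simp only: poly_action_def sum_subtractf vec.sum vec.scale_sum_right)
qed

text \<open>The space has dimension \<open>n = CARD('p)\<close>, so the \<open>n + 1\<close> vectors
  \<open>v, A v, ..., A^n v\<close> satisfy a nontrivial linear relation. The polynomial may depend
  on \<open>v\<close>.\<close>

lemma exists_annihilating_poly:
  fixes A :: "complex^'p^'p"
  shows "\<exists>p. p \<noteq> 0 \<and> poly_action A p v = 0"
proof -
  define n where "n = CARD('p)"
  define u where "u i = ((*v) A ^^ i) v" for i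
  \<comment> \<open>Linear dependence is a property of sets and does not see repetitions. Two equal
    iterates are therefore treated apart, with the polynomial \<open>X^i - X^j\<close>.\<close>
  show ?thesis
  proof (cases "inj_on u {..n}")
    case False
    then obtain i j where ij: "i \<noteq> j" "u i = u j" by (auto simp: inj_on_def)
    define p where "p = monom (1::complex) i - monom 1 j"
    have "coeff p i = 1" using ij by (simp add: p_def)
    hence "p \<noteq> 0" by auto
    have "degree p \<le> max i j"
      unfolding p_def by (intro degree_diff_le) (auto simp: degree_monom_eq)
    from poly_action_extend[OF this] have "poly_action A p v = (\<Sum>k\<le>max i j. coeff p k *s u k)"
      by (simp add: u_def)
    also have "\<dots> = (\<Sum>k\<in>{i,j}. coeff p k *s u k)"
      by (rule sum.mono_neutral_right) (auto simp: p_def)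
    also have "\<dots> = 0" using ij by (simp add: p_def)
    finally show ?thesis using \<open>p \<noteq> 0\<close> by blast
  next
    case True
    have "card (u ` {..n}) = Suc n" using card_image[OF True] by simp
    moreover have "vec.dim (u ` {..n}) \<le> n"
      using vec.dim_subset_UNIV[of "u ` {..n}"] by (simp add: n_def vec.dimension_def card_cart_basis)
    ultimately have "vec.dependent (u ` {..n})"
      by (intro vec.dependent_biggerset_general) simp
    then obtain c where c: "\<exists>w\<in>u ` {..n}. c w \<noteq> 0" "(\<Sum>w\<in>u ` {..n}. c w *s w) = 0"
      unfolding vec.dependent_finite[OF finite_imageI[OF finite_atMost]] by blast
    define p where "p = (\<Sum>i\<le>n. monom (c (u i)) i)"
    have cp: "coeff p i = (if i \<le> n then c (u i) else 0)" for i
      by (simp add: p_def coeff_sum)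
    have "p \<noteq> 0" using c(1) cp by (auto simp: poly_eq_iff)
    have "degree p \<le> n" by (rule degree_le) (simp add: cp)
    from poly_action_extend[OF this] have "poly_action A p v = (\<Sum>i\<le>n. c (u i) *s u i)"
      by (simp add: u_def cp)
    also have "\<dots> = 0" using c(2) sum.reindex[OF True, of "\<lambda>w. c w *s w"] by simp
    finally show ?thesis using \<open>p \<noteq> 0\<close> by blast
  qed
qed

text \<open>Once the forcing term is small, the recursion is unrolled from that index on: the memory
  of the start decays geometrically, and the accumulated forcing stays below
  \<open>r / 2\<close>.\<close>

lemma tendsto_zero_of_contracting_recursion:
  fixes y e :: "nat \<Rightarrow> complex"
  assumes rec: "\<And>i. y (Suc i) = z * y i + e i" and z: "cmod z < 1" and e: "e \<longlonglongrightarrow> 0"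
  shows "y \<longlonglongrightarrow> 0"
proof (rule LIMSEQ_I)
  fix r :: real assume r: "r > 0"
  define q where "q = cmod z"
  have q: "0 \<le> q" "q < 1" using z by (auto simp: q_def)
  \<comment> \<open>The threshold makes \<open>r / 2\<close> the fixed point of
    \<open>u \<mapsto> q * u + (1 - q) * (r / 2)\<close>, so the bound reproduces itself in the
    induction.\<close>
  obtain N where N: "\<And>i. i \<ge> N \<Longrightarrow> norm (e i - 0) < (1 - q) * (r / 2)"
    using LIMSEQ_D[OF e, of "(1 - q) * (r / 2)"] q r by auto
  have b: "cmod (y (N + k)) \<le> q ^ k * cmod (y N) + r / 2" for k
  proof (induction k)
    case 0 then show ?case using r by simp
  next
    case (Suc k)
    have "cmod (y (N + Suc k)) \<le> q * cmod (y (N + k)) + cmod (e (N + k))"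
      using norm_triangle_ineq[of "z * y (N + k)" "e (N + k)"] by (simp add: rec q_def norm_mult)
    also have "\<dots> \<le> q * (q ^ k * cmod (y N) + r / 2) + (1 - q) * (r / 2)"
      using N[of "N + k"] Suc q by (intro add_mono mult_left_mono) auto
    also have "\<dots> = q ^ Suc k * cmod (y N) + r / 2" by (simp add: field_simps)
    finally show ?case .
  qed
  have "(\<lambda>k. q ^ k * cmod (y N)) \<longlonglongrightarrow> 0"
    using LIMSEQ_power_zero[of q] q by (intro tendsto_mult_left_zero) auto
  from LIMSEQ_D[OF this, of "r / 2"] r
  obtain M where M: "\<And>k. k \<ge> M \<Longrightarrow> \<bar>q ^ k * cmod (y N)\<bar> < r / 2" by auto
  show "\<exists>no. \<forall>n\<ge>no. norm (y n - 0) < r"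
  proof (intro exI allI impI)
    fix n assume "n \<ge> N + M"
    then obtain k where k: "n = N + k" "M \<le> k" using le_Suc_ex[of "N + M" n] by (auto simp: add.assoc)
    show "norm (y n - 0) < r"
      using b[of k] M[OF k(2)] by (simp add: k(1))
  qed
qed

text \<open>Induction on the degree of an annihilating polynomial of \<open>v\<close>: a root \<open>z\<close> with \<open>cmod z < 1\<close> gives
  a contracting recursion driven by the iterates of \<open>A v - z v\<close>, and any other root is no eigenvalue
  and can be cancelled.\<close>

lemma funpow_tendsto_zero_of_poly:
  fixes A :: "complex^'p^'p"
  assumes spec: "\<And>z w. A *v w = z *s w \<Longrightarrow> w \<noteq> 0 \<Longrightarrow> cmod z < 1"
    and "p \<noteq> 0" "poly_action A p v = 0"
  shows "(\<lambda>i. ((*v) A ^^ i) v) \<longlonglongrightarrow> 0"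
  using assms(2,3)
proof (induction "degree p" arbitrary: p v)
  case 0
  then obtain c where "p = [:c:]" by (metis degree_eq_zeroE)
  with 0 have "v = 0" by (simp add: poly_action_def)
  have "((*v) A ^^ i) 0 = 0" for i by (induction i) auto
  then show ?case using \<open>v = 0\<close> by simp
next
  case (Suc n)
  have "\<not> constant (poly p)" using Suc.hyps(2) constant_degree[of p] by simp
  then obtain z where "poly p z = 0" using fundamental_theorem_of_algebra by blast
  then obtain q where q: "p = [:- z, 1:] * q" by (auto simp: poly_eq_0_iff_dvd elim: dvdE)
  have "q \<noteq> 0" using Suc.prems q by auto
  then have dq: "degree q = n" using Suc.hyps(2) q degree_mult_eq[of "[:- z, 1:]" q] by simp
  have pq: "A *v poly_action A q v - z *s poly_action A q v = 0"
    using Suc.prems(2) unfolding q poly_action_linear_factor .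
  show ?case
  proof (cases "cmod z < 1")
    case True
    have "poly_action A q (A *v v - z *s v) = 0" using pq by (simp add: poly_action_commute)
    from Suc.hyps(1)[OF dq[symmetric] \<open>q \<noteq> 0\<close> this]
    have lim: "(\<lambda>i. ((*v) A ^^ i) (A *v v - z *s v)) \<longlonglongrightarrow> 0" .
    show ?thesis
    proof (rule vec_tendstoI)
      fix j
      have "(\<lambda>i. ((*v) A ^^ i) v $ j) \<longlonglongrightarrow> 0"
      proof (rule tendsto_zero_of_contracting_recursion[OF _ True])
        show "(\<lambda>i. ((*v) A ^^ i) (A *v v - z *s v) $ j) \<longlonglongrightarrow> 0"
          using tendsto_vec_nth[OF lim, of j] by simp
        show "((*v) A ^^ Suc i) v $ j = z * (((*v) A ^^ i) v $ j) + ((*v) A ^^ i) (A *v v - z *s v) $ j" for i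
          by (simp add: funpow_matrix_diff_scale)
      qed
      then show "(\<lambda>i. ((*v) A ^^ i) v $ j) \<longlonglongrightarrow> 0 $ j" by simp
    qed
  next
    case False
    then have "poly_action A q v = 0" using spec[of "poly_action A q v" z] pq by (metis eq_iff_diff_eq_0)
    then show ?thesis using Suc.hyps(1)[OF dq[symmetric] \<open>q \<noteq> 0\<close>] by blast
  qed
qed

section \<open>Spectral radius of a real matrix, invertibility and affine iteration\<close>

text \<open>Every eigenvalue has modulus at most the operator norm. Boundedness is what makes the
  supremum in \<open>spectral_rad\<close> an upper bound.\<close>

lemma bdd_above_spectrum: "bdd_above (cmod ` spectrum_of A)" for A :: "real^'p^'p"
proof -
  define c where "c = map_matrix complex_of_real A"
  define K where "K = onorm ((*v) c)"
  have "cmod z \<le> K" if "v \<noteq> 0" "c *v v = z *s v" for z and v :: "complex^'p"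
  proof -
    have bl: "bounded_linear ((*v) c)" by simp
    have "norm (z *s v) = cmod z * norm v"
      by (simp add: norm_vec_def L2_set_def norm_mult power_mult_distrib sum_distrib_left[symmetric] real_sqrt_mult)
    with onorm[OF bl, of v] that show ?thesis by (simp add: K_def)
  qed
  then show ?thesis by (auto simp: bdd_above_def spectrum_of_def c_def)
qed

lemma cmod_le_spectral_rad:
  assumes "map_matrix complex_of_real A *v v = z *s v" "v \<noteq> 0"
  shows "cmod z \<le> spectral_rad A"
  unfolding spectral_rad_def using assms
  by (intro cSup_upper bdd_above_spectrum) (auto simp: spectrum_of_def)

lemma map_matrix_of_real_mult:
  "map_matrix complex_of_real A *v (\<chi> i. complex_of_real (v $ i)) = (\<chi> i. complex_of_real ((A *v v) $ i))"
  by (simp add: vec_eq_iff matrix_vector_mult_def map_matrix_def)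

text \<open>Eigenvalues are complex, so matrix and vector are embedded into the complex numbers; the
  embedding commutes with iteration, and the limit is read off coordinatewise.\<close>

lemma funpow_tendsto_zero_of_spectral_rad:
  fixes A :: "real^'p^'p"
  assumes "spectral_rad A < 1"
  shows "(\<lambda>i. ((*v) A ^^ i) v) \<longlonglongrightarrow> 0"
proof -
  define B where "B = map_matrix complex_of_real A"
  define w :: "complex^'p" where "w = (\<chi> i. complex_of_real (v $ i))"
  obtain p where "p \<noteq> 0" "poly_action B p w = 0" using exists_annihilating_poly by blast
  then have lim: "(\<lambda>i. ((*v) B ^^ i) w) \<longlonglongrightarrow> 0"
    using cmod_le_spectral_rad[of A] assms le_less_trans unfolding B_def
    by (intro funpow_tendsto_zero_of_poly) blast+
  have eq: "((*v) B ^^ i) w = (\<chi> j. complex_of_real ((((*v) A ^^ i) v) $ j))" for i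
    by (induction i) (simp_all add: B_def w_def map_matrix_of_real_mult)
  show ?thesis
  proof (rule vec_tendstoI)
    fix j
    have "(\<lambda>i. complex_of_real ((((*v) A ^^ i) v) $ j)) \<longlonglongrightarrow> complex_of_real 0"
      using tendsto_vec_nth[OF lim, of j] by (simp add: eq)
    then show "(\<lambda>i. (((*v) A ^^ i) v) $ j) \<longlonglongrightarrow> 0 $ j"
      by (simp only: tendsto_of_real_iff zero_index)
  qed
qed

lemma invertible_of_injective:
  fixes A :: "real^'p^'p"
  assumes "\<And>v. A *v v = 0 \<Longrightarrow> v = 0"
  shows "invertible A"
  using assms by (metis matrix_left_invertible_ker invertible_left_inverse)

lemma matrix_inv_right:
  fixes A :: "real^'p^'p"
  assumes "invertible A"
  shows "A ** matrix_inv A = mat 1"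
  using someI_ex[OF assms[unfolded invertible_def]] unfolding matrix_inv_def by blast

text \<open>A nonzero kernel vector of \<open>mat 1 - A\<close> would be an eigenvector of
  \<open>A\<close> for the eigenvalue 1.\<close>

lemma invertible_one_minus_of_spectral_rad:
  fixes A :: "real^'p^'p"
  assumes "spectral_rad A < 1"
  shows "invertible (mat 1 - A)"
proof (rule invertible_of_injective)
  fix v :: "real^'p" assume "(mat 1 - A) *v v = 0"
  then have Av: "A *v v = v" by (simp add: matrix_vector_mult_diff_rdistrib)
  define w :: "complex^'p" where "w = (\<chi> i. complex_of_real (v $ i))"
  have "map_matrix complex_of_real A *v w = 1 *s w"
    unfolding w_def map_matrix_of_real_mult Av by simp
  then have "w = 0" using cmod_le_spectral_rad[of A w 1] assms by auto
  then show "v = 0" by (simp add: w_def vec_eq_iff)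
qed

text \<open>The claimed limit \<open>x\<close> is the fixed point of the affine map, and the
  deviation \<open>m i - x\<close> evolves linearly under \<open>A\<close>.\<close>

lemma affine_iteration_tendsto:
  fixes A :: "real^'p^'p"
  assumes "spectral_rad A < 1" and rec: "\<And>i. m (Suc i) = A *v m i + b"
  shows "m \<longlonglongrightarrow> matrix_inv (mat 1 - A) *v b"
proof -
  define x where "x = matrix_inv (mat 1 - A) *v b"
  have "(mat 1 - A) *v x = b"
    unfolding x_def using invertible_one_minus_of_spectral_rad[OF assms(1)]
    by (simp add: matrix_vector_mul_assoc matrix_inv_right)
  then have fix_x: "x = A *v x + b" by (simp add: matrix_vector_mult_diff_rdistrib algebra_simps)
  have "m i - x = ((*v) A ^^ i) (m 0 - x)" for i
  proof (induction i)
    case (Suc i)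
    have "m (Suc i) - x = A *v (m i - x)"
      by (subst fix_x) (simp add: rec matrix_vector_mult_diff_distrib)
    then show ?case by (simp add: Suc)
  qed simp
  then have "(\<lambda>i. m i - x) = (\<lambda>i. ((*v) A ^^ i) (m 0 - x))" by (rule ext)
  then have "(\<lambda>i. m i - x) \<longlonglongrightarrow> 0"
    using funpow_tendsto_zero_of_spectral_rad[OF assms(1), of "m 0 - x"] by metis
  then show ?thesis unfolding x_def by (simp add: LIM_zero_iff)
qed

section \<open>Block vectors and the diffusion fixed point\<close>

text \<open>Inverse of \<open>col\<close> on vectors; identities between network vectors are checked
  one agent at a time.\<close>

definition block :: "real^('n::finite \<times> 'p::finite) \<Rightarrow> 'n \<Rightarrow> real^'p" where
  "block x k = (\<chi> q. x $ (k, q))"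

lemma col_block [simp]: "col (block x) = x"
  by (simp add: vec_eq_iff col_def block_def)

lemma block_col [simp]: "block (col v) k = v k"
  by (simp add: vec_eq_iff col_def block_def)

lemma block_linear [simp]:
  "block 0 k = 0"
  "block (x + y) k = block x k + block y k"
  "block (x - y) k = block x k - block y k"
  "block (c *\<^sub>R x) k = c *\<^sub>R block x k"
  by (simp_all add: vec_eq_iff block_def)

lemma sum_UNIV_prod: "(\<Sum>j\<in>UNIV. f j) = (\<Sum>a\<in>UNIV. \<Sum>b\<in>UNIV. f (a, b))"
  for f :: "'a::finite \<times> 'b::finite \<Rightarrow> 'c::comm_monoid_add"
  by (simp add: sum.cartesian_product)

text \<open>The identity factor acts trivially inside a block, and the transpose selects column
  \<open>k\<close> of \<open>C\<close>: this is the combination step of the algorithm.\<close>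

lemma block_transpose_kronecker:
  fixes C :: "real^'n^'n" and x :: "real^('n \<times> 'p::finite)"
  shows "block (transpose (kronecker C (mat 1)) *v x) k = (\<Sum>l\<in>UNIV. C $ l $ k *\<^sub>R block x l)"
  by (simp add: vec_eq_iff block_def kronecker_def transpose_def matrix_vector_mult_def mat_def
      sum_UNIV_prod if_distrib if_distribR cong: if_cong)

lemma block_block_diag: "block (block_diag G *v x) k = G k *v block x k"
proof -
  have "(\<Sum>a\<in>UNIV. \<Sum>b\<in>UNIV. (if k = a then G (fst (k, p)) $ snd (k, p) $ snd (a, b) else 0) * x $ (a, b)) =
      (\<Sum>a\<in>UNIV. if k = a then \<Sum>b\<in>UNIV. G k $ p $ b * x $ (a, b) else 0)" for p
    by (intro sum.cong refl) simp
  then show ?thesis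
    by (simp add: vec_eq_iff block_def block_diag_def matrix_vector_mult_def sum_UNIV_prod)
qed

lemma block_col_matrix: "block (col G *v y) k = G k *v y"
  by (simp add: vec_eq_iff block_def col_def matrix_vector_mult_def)

section \<open>Left fixed vectors of a primitive matrix\<close>

lemma vector_matrix_funpow_fixed:
  fixes C :: "real^'n^'n"
  assumes "z v* C = z"
  shows "z v* (((**) C ^^ p) (mat 1)) = z"
proof (induction p)
  case (Suc p)
  then show ?case by (simp add: vector_matrix_mul_assoc[symmetric] assms)
qed simp

text \<open>Maximum principle: for a strictly positive power \<open>E\<close> with unit column sums,
  the maximal entry of \<open>z\<close> is an average of all entries with positive weights, so all
  entries equal it.\<close>

lemma primitive_left_fixed_constant:
  fixes C :: "real^'n^'n"
  assumes "left_stochastic C" "primitive_matrix C" "z v* C = z"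
  shows "z $ k = z $ l"
proof -
  obtain p where pos: "\<And>l k. (((**) C ^^ p) (mat 1)) $ l $ k > 0"
    using assms(2) by (auto simp: primitive_matrix_def)
  define E where "E = ((**) C ^^ p) (mat 1)"
  \<comment> \<open>Left-stochasticity says that the all-ones vector is a left fixed vector, a
    property that passes to the power \<open>E\<close>.\<close>
  have "(1::real^'n) v* C = 1"
    using assms(1) by (simp add: left_stochastic_def vec_eq_iff vector_matrix_mult_def)
  then have one: "1 v* E = 1" unfolding E_def by (rule vector_matrix_funpow_fixed)
  have fixed: "z v* E = z" unfolding E_def using assms(3) by (rule vector_matrix_funpow_fixed)
  have "Max (range (($) z)) \<in> range (($) z)" by (rule Max_in) auto
  then obtain m where zm: "Max (range (($) z)) = z $ m" by blast
  have m: "z $ l \<le> z $ m" for l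
    unfolding zm[symmetric] by (rule Max_ge) auto
  have "(\<Sum>l\<in>UNIV. E $ l $ m * (z $ m - z $ l)) = (1 v* E) $ m * z $ m - (z v* E) $ m"
    by (simp add: vector_matrix_mult_def right_diff_distrib sum_subtractf sum_distrib_left mult.commute)
  then have "(\<Sum>l\<in>UNIV. E $ l $ m * (z $ m - z $ l)) = 0"
    by (simp add: one fixed)
  then have "E $ l $ m * (z $ m - z $ l) = 0" for l
    using sum_nonneg_eq_0_iff[of UNIV "\<lambda>l. E $ l $ m * (z $ m - z $ l)"] m pos
    by (simp add: E_def less_imp_le)
  then have "z $ l = z $ m" for l
    using pos[of l m] by (metis E_def eq_iff_diff_eq_0 less_irrefl mult_eq_0_iff)
  then show ?thesis by metis
qed

section \<open>Solutions of the diffusion fixed-point equation for small step-sizes\<close>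

text \<open>After exchanging the sums, block \<open>l\<close> carries the weight
  \<open>(C *v t) $ l = t $ l\<close>: the weighted block sum is conserved by the combination
  step.\<close>

lemma perron_weighted_block_sum:
  fixes C :: "real^'n^'n" and x :: "real^('n \<times> 'p::finite)"
  assumes "perron_eigenvector C t"
  shows "(\<Sum>k\<in>UNIV. t $ k *\<^sub>R block (transpose (kronecker C (mat 1)) *v x) k) = (\<Sum>k\<in>UNIV. t $ k *\<^sub>R block x k)"
proof -
  have Ct: "(\<Sum>k\<in>UNIV. C $ l $ k * t $ k) = t $ l" for l
    using assms by (auto simp: perron_eigenvector_def vec_eq_iff matrix_vector_mult_def)
  have "(\<Sum>k\<in>UNIV. t $ k *\<^sub>R block (transpose (kronecker C (mat 1)) *v x) k) =
      (\<Sum>k\<in>UNIV. \<Sum>l\<in>UNIV. (C $ l $ k * t $ k) *\<^sub>R block x l)"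
    by (simp add: block_transpose_kronecker scaleR_sum_right mult.commute del: transpose_matrix_vector)
  also have "\<dots> = (\<Sum>l\<in>UNIV. t $ l *\<^sub>R block x l)"
    by (subst sum.swap) (simp add: scaleR_sum_left[symmetric] Ct)
  finally show ?thesis .
qed

text \<open>The constants precede \<open>\<mu>\<close>, \<open>x\<close> and \<open>b\<close>, so
  the bound is uniform. With \<open>b = 0\<close> it forces \<open>x = 0\<close>, from which
  invertibility at small step-sizes will follow.\<close>

lemma diffusion_fixed_point_bound:
  fixes C :: "real^'n^'n" and G :: "'n \<Rightarrow> real^('p::finite)^'p"
  assumes ls: "left_stochastic C" and prim: "primitive_matrix C" and perron: "perron_eigenvector C t"
    and inj: "\<And>y. (\<Sum>k\<in>UNIV. t $ k *\<^sub>R (G k *v y)) = 0 \<Longrightarrow> y = 0"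
  obtains K \<mu>1 where "K > 0" "\<mu>1 > 0"
    "\<And>\<mu> x b. 0 < \<mu> \<Longrightarrow> \<mu> < \<mu>1 \<Longrightarrow> (\<Sum>k\<in>UNIV. t $ k *\<^sub>R block b k) = 0 \<Longrightarrow>
       x = transpose (kronecker C (mat 1)) *v (x - \<mu> *\<^sub>R (block_diag G *v x) + \<mu> *\<^sub>R b) \<Longrightarrow>
       norm x \<le> K * \<mu> * norm b"
proof -
  define P :: "real^('n \<times> 'p)^('n \<times> 'p)" where "P = transpose (kronecker C (mat 1))"
  define R where "R = block_diag G"
  define T where "T u = (\<Sum>k\<in>UNIV. t $ k *\<^sub>R block u k)" for u :: "real^('n \<times> 'p)"
  have T_linear: "T (u + v) = T u + T v" "T (u - v) = T u - T v" "T (c *\<^sub>R u) = c *\<^sub>R T u" for u v c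
    by (simp_all add: T_def scaleR_add_right scaleR_diff_right sum.distrib sum_subtractf scaleR_sum_right mult.commute)
  txt \<open>An injective linear map is bounded below; the image under \<open>L\<close> of a solution is \<open>O(\<mu>)\<close>,
    because the weighted block sum of \<open>R x\<close> vanishes.\<close>
  define L where "L x = (x - P *v x, T (R *v x))" for x
  have "linear L"
    by (rule linearI) (simp_all add: L_def T_linear matrix_vector_right_distrib scaleR_matrix_vector_assoc[symmetric]
        matrix_vector_mult_scaleR scaleR_diff_right)
  moreover have "inj L"
    unfolding linear_injective_0[OF \<open>linear L\<close>]
  proof (intro allI impI)
    fix x assume "L x = 0"
    then have Px: "P *v x = x" and TR: "T (R *v x) = 0" by (auto simp: L_def zero_prod_def)
    \<comment> \<open>For each coordinate \<open>q\<close>, the entries of \<open>x\<close> across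
      the agents form a left fixed vector of \<open>C\<close>.\<close>
    have const: "block x k = block x l" for k l
    proof -
      have "(\<chi> k. x $ (k, q)) v* C = (\<chi> k. x $ (k, q))" for q
      proof -
        have "(\<Sum>l\<in>UNIV. C $ l $ k * x $ (l, q)) = x $ (k, q)" for k
          using arg_cong[OF block_transpose_kronecker[of C x k], of "\<lambda>v. v $ q"] Px
          by (simp add: P_def block_def)
        then show ?thesis by (simp add: vec_eq_iff vector_matrix_mult_def mult.commute)
      qed
      from primitive_left_fixed_constant[OF ls prim this, where k = k and l = l]
      show ?thesis by (simp add: block_def vec_eq_iff)
    qed
    \<comment> \<open>Here \<open>undefined\<close> is merely some agent; all blocks agree.\<close>
    define y where "y = block x undefined"
    have y: "block x k = y" for k unfolding y_def by (rule const)
    have "(\<Sum>k\<in>UNIV. t $ k *\<^sub>R (G k *v y)) = 0"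
      using TR by (simp add: T_def R_def block_block_diag y)
    then have "y = 0" by (rule inj)
    have "x = col (block x)" by simp
    also have "\<dots> = 0" by (simp add: y \<open>y = 0\<close> col_def vec_eq_iff)
    finally show "x = 0" .
  qed
  ultimately obtain B where B: "B > 0" "\<And>x. B * norm x \<le> norm (L x)"
    using linear_inj_bounded_below_pos by blast
  obtain c where c: "c > 0" "\<And>u. norm (P *v u) \<le> c * norm u"
    using bounded_linear.pos_bounded[OF matrix_vector_mul_bounded_linear[of P]] by (auto simp: mult.commute)
  obtain r where r: "r > 0" "\<And>u. norm (R *v u) \<le> r * norm u"
    using bounded_linear.pos_bounded[OF matrix_vector_mul_bounded_linear[of R]] by (auto simp: mult.commute)
  show thesis
  proof (rule that)
    \<comment> \<open>Below the threshold, \<open>\<mu> * (c * r)\<close> is at most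
      \<open>B / 2\<close>, so the term in \<open>norm x\<close> on the right is absorbed by half of
      the lower bound \<open>B * norm x\<close>; the factor 2 in \<open>2 * c / B\<close> is the
      price.\<close>
    show "2 * c / B > 0" "B / (2 * (c * r)) > 0" using B(1) c(1) r(1) by auto
    fix \<mu> :: real and x b
    assume \<mu>: "0 < \<mu>" "\<mu> < B / (2 * (c * r))" and Tb: "(\<Sum>k\<in>UNIV. t $ k *\<^sub>R block b k) = 0"
      and "x = transpose (kronecker C (mat 1)) *v (x - \<mu> *\<^sub>R (block_diag G *v x) + \<mu> *\<^sub>R b)"
    then have x: "x = P *v (x - \<mu> *\<^sub>R (R *v x) + \<mu> *\<^sub>R b)" by (simp add: P_def R_def)
    \<comment> \<open>\<open>T\<close> does not see \<open>P\<close>; then \<open>T x\<close>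
      cancels, \<open>T b\<close> vanishes, and what is left is \<open>\<mu>\<close> times
      \<open>T (R *v x)\<close>.\<close>
    have "T x = T (x - \<mu> *\<^sub>R (R *v x) + \<mu> *\<^sub>R b)"
      by (subst x) (simp only: T_def P_def perron_weighted_block_sum[OF perron])
    then have "T (R *v x) = 0"
      using \<mu>(1) Tb by (simp add: T_linear T_def[of b])
    moreover have "P *v (x - \<mu> *\<^sub>R (R *v x) + \<mu> *\<^sub>R b) = P *v x + \<mu> *\<^sub>R (P *v (b - R *v x))"
      by (simp add: matrix_vector_right_distrib matrix_vector_mult_diff_distrib matrix_vector_mult_scaleR scaleR_diff_right)
    then have "x - P *v x = \<mu> *\<^sub>R (P *v (b - R *v x))" using x by (metis add_diff_cancel_left')
    ultimately have "norm (L x) = \<mu> * norm (P *v (b - R *v x))"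
      using \<mu>(1) by (simp add: L_def norm_Pair)
    also have "\<dots> \<le> \<mu> * (c * (norm b + r * norm x))"
      using \<mu>(1) c r(2)[of x] norm_triangle_ineq4[of b "R *v x"]
      by (intro mult_left_mono order_trans[OF c(2)]) auto
    finally have "B * norm x \<le> \<mu> * c * norm b + \<mu> * (c * r) * norm x"
      using B(2)[of x] by (simp add: algebra_simps)
    moreover have "\<mu> * (c * r) * norm x \<le> B / 2 * norm x"
      using \<mu>(2) c(1) r(1) by (intro mult_right_mono) (auto simp: field_simps)
    ultimately have "B / 2 * norm x \<le> \<mu> * c * norm b" by simp
    then show "norm x \<le> 2 * c / B * \<mu> * norm b" using B(1) by (simp add: field_simps)
  qed
qed

section \<open>Two-by-two blocks and weighted sums of matrices\<close>

lemma four_block_mult: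
  "four_block A B C D *v vec_append u w = vec_append (A *v u + B *v w) (C *v u + D *v w)"
proof -
  have "(four_block A B C D *v vec_append u w) $ i = vec_append (A *v u + B *v w) (C *v u + D *v w) $ i" for i
    by (cases i) (simp_all add: four_block_def vec_append_def matrix_vector_mult_def UNIV_Plus_UNIV[symmetric] sum.Plus del: UNIV_Plus_UNIV)
  then show ?thesis by (simp add: vec_eq_iff)
qed

lemma vec_append_linear:
  "vec_append u w + vec_append u' w' = vec_append (u + u') (w + w')"
  "c *\<^sub>R vec_append u w = vec_append (c *\<^sub>R u) (c *\<^sub>R w)"
  "vec_append u w = 0 \<longleftrightarrow> u = 0 \<and> w = 0"
  by (auto simp: vec_eq_iff vec_append_def split: sum.splits)

lemma sum_vec_append: "(\<Sum>k\<in>K. vec_append (f k) (g k)) = vec_append (sum f K) (sum g K)"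
  by (induction K rule: infinite_finite_induct) (auto simp: vec_append_linear)

lemma vec_append_cases: obtains u w where "x = vec_append u w"
proof
  show "x = vec_append (\<chi> i. x $ Inl i) (\<chi> i. x $ Inr i)"
    by (simp add: vec_eq_iff vec_append_def split: sum.splits)
qed

lemma weighted_matrix_sum_mult:
  "(\<Sum>k\<in>K. c k *\<^sub>R M k) *v v = (\<Sum>k\<in>K. c k *\<^sub>R (M k *v v))"
  for M :: "'k \<Rightarrow> real^'p^'q"
  by (induction K rule: infinite_finite_induct)
    (simp_all add: matrix_vector_mult_add_rdistrib scaleR_matrix_vector_assoc)

lemma matrix_weighted_sum_mult:
  "A *v (\<Sum>k\<in>K. c k *\<^sub>R v k) = (\<Sum>k\<in>K. c k *\<^sub>R (A *v v k))"
  for A :: "real^'p^'q"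
  by (induction K rule: infinite_finite_induct)
    (simp_all add: matrix_vector_right_distrib matrix_vector_mult_scaleR)

lemma uminus_matrix_vector_mult: "(- A) *v v = - (A *v v)" for A :: "real^'p^'q"
  by (simp add: vec_eq_iff matrix_vector_mult_def sum_negf)

lemma transpose_weighted_sum:
  "transpose (\<Sum>k\<in>K. c k *\<^sub>R M k) = (\<Sum>k\<in>K. c k *\<^sub>R transpose (M k))"
  for M :: "'k \<Rightarrow> real^'p^'q"
  by (simp add: vec_eq_iff transpose_def)

section \<open>Mean quantities\<close>

lemma expectation_sample_pmf:
  fixes pr :: "('s::finite, 'a::finite, 'n::finite, 'm::finite) gtd_problem"
    and f :: "'s \<times> 'a \<times> 's \<Rightarrow> real"
  shows "measure_pmf.expectation (sample_pmf pr k) f =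
    (\<Sum>s\<in>UNIV. pmf (stat_dist pr k) s * (\<Sum>a\<in>UNIV. pmf (behavior pr k s) a *
       (\<Sum>s'\<in>UNIV. pmf (trans_prob pr s a) s' * f (s, a, s'))))"
  unfolding sample_pmf_def
  by (simp add: pmf_expectation_bind[where A = UNIV]
      integral_measure_pmf[where A = UNIV and M = "trans_prob pr s a" for s a])

lemma sum_pmf_UNIV [simp]: "(\<Sum>x\<in>UNIV. pmf p x) = 1" for p :: "'a::finite pmf"
  using sum_pmf_eq_1[of UNIV p] by simp

context gtd_setting begin

text \<open>Change of measure: the importance weight replaces the behavior policy by the target
  policy, while the state distribution stays that of agent \<open>k\<close>.\<close>

lemma expectation_importance:
  "measure_pmf.expectation (sample_pmf pr k) (\<lambda>(s, a, s'). importance pr k a s * h s a s') =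
    (\<Sum>s\<in>UNIV. pmf (stat_dist pr k) s * (\<Sum>a\<in>UNIV. pmf (target pr s) a *
       (\<Sum>s'\<in>UNIV. pmf (trans_prob pr s a) s' * h s a s')))"
proof -
  \<comment> \<open>If the behavior probability is 0, the left side vanishes; by
    \<open>coverage\<close> the state then has probability 0 or the target policy avoids the action,
    so the right side vanishes too.\<close>
  have "pmf (stat_dist pr k) s * (pmf (behavior pr k s) a * importance pr k a s) =
      pmf (stat_dist pr k) s * pmf (target pr s) a" for s a
    using coverage[of k s a] pmf_nonneg[of "stat_dist pr k" s] pmf_nonneg[of "target pr s" a]
    by (cases "pmf (stat_dist pr k) s = 0"; cases "pmf (target pr s) a = 0")
      (auto simp: importance_def)
  then have *: "pmf (stat_dist pr k) s * (pmf (behavior pr k s) a * (importance pr k a s * v)) =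
      pmf (stat_dist pr k) s * (pmf (target pr s) a * v)" for s a v
    by (metis mult.assoc)
  have "(\<Sum>s'\<in>UNIV. pmf (trans_prob pr s a) s' * (importance pr k a s * h s a s')) =
      importance pr k a s * (\<Sum>s'\<in>UNIV. pmf (trans_prob pr s a) s' * h s a s')" for s a
    by (simp add: sum_distrib_left mult.left_commute)
  then show ?thesis
    by (simp add: expectation_sample_pmf sum_distrib_left[where r = "pmf (stat_dist pr k) s" for s] *)
qed

text \<open>Under the target policy the next-state feature averages to the corresponding row of
  \<open>P X\<close>. The free factor \<open>c\<close> serves both off-diagonal blocks of
  \<open>G_sample\<close>, with \<open>eta pr\<close> and with -1.\<close>

lemma expectation_importance_td:
  "measure_pmf.expectation (sample_pmf pr k)
     (\<lambda>(s, a, s'). importance pr k a s * (c * feat pr $ s $ p * (feat pr $ s $ q - discount pr * feat pr $ s' $ q))) =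
   c * td_matrix pr (state_weighting pr k) $ p $ q"
proof -
  \<comment> \<open>Action and transition probabilities sum to one, so the part depending on
    \<open>s\<close> alone passes through both averages.\<close>
  have next_state: "(\<Sum>a\<in>UNIV. pmf (target pr s) a * (\<Sum>s'\<in>UNIV. pmf (trans_prob pr s a) s' * (u s - g * u s'))) =
      u s - g * (\<Sum>s'\<in>UNIV. trans_matrix pr $ s $ s' * u s')" for s u and g :: real
  proof -
    have "(\<Sum>s'\<in>UNIV. pmf (trans_prob pr s a) s' * (u s - g * u s')) =
        u s - g * (\<Sum>s'\<in>UNIV. pmf (trans_prob pr s a) s' * u s')" for a
      by (simp add: right_diff_distrib sum_subtractf sum_distrib_right[symmetric] sum_distrib_left mult.left_commute)
    then have "(\<Sum>a\<in>UNIV. pmf (target pr s) a * (\<Sum>s'\<in>UNIV. pmf (trans_prob pr s a) s' * (u s - g * u s'))) =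
        u s - g * (\<Sum>a\<in>UNIV. \<Sum>s'\<in>UNIV. pmf (target pr s) a * (pmf (trans_prob pr s a) s' * u s'))"
      by (simp add: right_diff_distrib sum_subtractf sum_distrib_right[symmetric] sum_distrib_left mult.left_commute)
    also have "(\<Sum>a\<in>UNIV. \<Sum>s'\<in>UNIV. pmf (target pr s) a * (pmf (trans_prob pr s a) s' * u s')) =
        (\<Sum>s'\<in>UNIV. trans_matrix pr $ s $ s' * u s')"
      by (subst sum.swap) (simp add: trans_matrix_def sum_distrib_left mult_ac)
    finally show ?thesis .
  qed
  have X: "((mat 1 - discount pr *\<^sub>R trans_matrix pr) ** feat pr) $ s $ q =
      feat pr $ s $ q - discount pr * (\<Sum>s'\<in>UNIV. trans_matrix pr $ s $ s' * feat pr $ s' $ q)" for s q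
  proof -
    have "(\<Sum>j\<in>UNIV. (if s = j then 1 else 0) * feat pr $ j $ q) = feat pr $ s $ q"
      by (simp add: if_distribR if_distrib cong: if_cong)
    then show ?thesis
      by (simp add: matrix_matrix_mult_def mat_def left_diff_distrib sum_subtractf sum_distrib_left mult.assoc)
  qed
  have XD: "(transpose (feat pr) ** state_weighting pr k) $ p $ s = feat pr $ s $ p * pmf (stat_dist pr k) s" for s p
    by (simp add: matrix_matrix_mult_def transpose_def state_weighting_def diag_matrix_def if_distrib cong: if_cong)
  have td_entry: "td_matrix pr (state_weighting pr k) $ p $ q =
      (\<Sum>s\<in>UNIV. pmf (stat_dist pr k) s * (feat pr $ s $ p *
         (feat pr $ s $ q - discount pr * (\<Sum>s'\<in>UNIV. trans_matrix pr $ s $ s' * feat pr $ s' $ q))))"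
    unfolding td_matrix_def matrix_mul_assoc[symmetric, of "transpose (feat pr) ** state_weighting pr k"]
    by (subst matrix_matrix_mult_def) (simp add: X XD mult_ac)
  have target_average: "(\<Sum>a\<in>UNIV. pmf (target pr s) a * (\<Sum>s'\<in>UNIV. pmf (trans_prob pr s a) s' *
        (e * (feat pr $ s $ q - discount pr * feat pr $ s' $ q)))) =
      e * (feat pr $ s $ q - discount pr * (\<Sum>s'\<in>UNIV. trans_matrix pr $ s $ s' * feat pr $ s' $ q))" for s e
    unfolding next_state[where u = "\<lambda>s. feat pr $ s $ q", symmetric]
    by (simp only: sum_distrib_left mult.left_commute[of e])
  show ?thesis
    unfolding expectation_importance target_average td_entry
    by (simp add: sum_distrib_left[of c] mult.assoc mult.left_commute[of c])
qed

text \<open>Apart from the importance weight the integrand depends on the state only, so the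
  averages over actions and next states collapse.\<close>

lemma expectation_importance_gram:
  "measure_pmf.expectation (sample_pmf pr k)
     (\<lambda>(s, a, s'). importance pr k a s * (c * feat pr $ s $ p * feat pr $ s $ q)) =
   c * gram pr (state_weighting pr k) $ p $ q"
proof -
  have gram_entry: "gram pr (state_weighting pr k) $ p $ q =
      (\<Sum>s\<in>UNIV. feat pr $ s $ p * pmf (stat_dist pr k) s * feat pr $ s $ q)"
    by (simp add: gram_def matrix_matrix_mult_def transpose_def state_weighting_def diag_matrix_def
        if_distrib cong: if_cong)
  have target_average: "(\<Sum>a\<in>UNIV. pmf (target pr s) a * (\<Sum>s'\<in>UNIV. pmf (trans_prob pr s a) s' * e)) = e" for s e
    by (simp add: sum_distrib_right[symmetric])
  show ?thesis
    unfolding expectation_importance target_average gram_entry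
    by (simp add: sum_distrib_left mult_ac)
qed

lemma expectation_importance_reward:
  "measure_pmf.expectation (sample_pmf pr k)
     (\<lambda>(s, a, s'). importance pr k a s * (c * reward pr s a s' * feat pr $ s $ p)) =
   c * td_vec pr (state_weighting pr k) $ p"
proof -
  have td_entry: "td_vec pr (state_weighting pr k) $ p =
      (\<Sum>s\<in>UNIV. pmf (stat_dist pr k) s * (feat pr $ s $ p * reward_vec pr $ s))"
    by (simp add: td_vec_def matrix_vector_mult_def transpose_def state_weighting_def diag_matrix_def
        if_distrib if_distribR mult_ac del: transpose_matrix_vector cong: if_cong)
  have target_average: "(\<Sum>a\<in>UNIV. pmf (target pr s) a * (\<Sum>s'\<in>UNIV. pmf (trans_prob pr s a) s' *
        (c * reward pr s a s' * feat pr $ s $ p))) = c * (feat pr $ s $ p * reward_vec pr $ s)" for s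
    by (simp add: reward_vec_def sum_distrib_left mult_ac)
  show ?thesis
    unfolding expectation_importance target_average td_entry
    by (simp add: sum_distrib_left[of c] mult.left_commute[of c])
qed

lemma expectation_G_sample:
  "measure_pmf.expectation (sample_pmf pr k) (\<lambda>t. G_sample pr k t $ i $ j) = G_mean pr k $ i $ j"
proof (cases i; cases j)
  fix p q assume ij: "i = Inl p" "j = Inl q"
  have "(\<lambda>t. G_sample pr k t $ i $ j) =
      (\<lambda>(s, a, s'). importance pr k a s * (eta pr * feat pr $ s $ p * feat pr $ s $ q))"
    by (auto simp: ij fun_eq_iff G_sample_def four_block_def outer_product_def Let_def)
  then show ?thesis
    by (simp add: expectation_importance_gram) (simp add: ij G_mean_def four_block_def Let_def)
next
  fix p q assume ij: "i = Inl p" "j = Inr q"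
  have "(\<lambda>t. G_sample pr k t $ i $ j) = (\<lambda>(s, a, s'). importance pr k a s *
      (eta pr * feat pr $ s $ p * (feat pr $ s $ q - discount pr * feat pr $ s' $ q)))"
    by (auto simp: ij fun_eq_iff G_sample_def four_block_def outer_product_def Let_def)
  then show ?thesis
    by (simp add: expectation_importance_td) (simp add: ij G_mean_def four_block_def Let_def)
next
  \<comment> \<open>The roles of \<open>p\<close> and \<open>q\<close> are exchanged here, which
    produces the transpose in the lower left block.\<close>
  fix p q assume ij: "i = Inr p" "j = Inl q"
  have "(\<lambda>t. G_sample pr k t $ i $ j) = (\<lambda>(s, a, s'). importance pr k a s *
      (- 1 * feat pr $ s $ q * (feat pr $ s $ p - discount pr * feat pr $ s' $ p)))"
    by (auto simp: ij fun_eq_iff G_sample_def four_block_def outer_product_def Let_def)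
  then show ?thesis
    by (simp only: expectation_importance_td) (simp add: ij G_mean_def four_block_def Let_def transpose_def)
next
  fix p q assume ij: "i = Inr p" "j = Inr q"
  have "(\<lambda>t. G_sample pr k t $ i $ j) = (\<lambda>t. 0)"
    by (auto simp: ij fun_eq_iff G_sample_def four_block_def Let_def)
  then show ?thesis by (simp add: ij G_mean_def four_block_def Let_def)
qed

lemma expectation_g_sample:
  "measure_pmf.expectation (sample_pmf pr k) (\<lambda>t. g_sample pr k t $ i) = g_mean pr k $ i"
proof (cases i)
  case (Inl p)
  have "(\<lambda>t. g_sample pr k t $ i) =
      (\<lambda>(s, a, s'). importance pr k a s * (- eta pr * reward pr s a s' * feat pr $ s $ p))"
    by (auto simp: Inl fun_eq_iff g_sample_def vec_append_def)
  then show ?thesis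
    by (simp only: expectation_importance_reward) (simp add: Inl g_mean_def vec_append_def)
next
  case (Inr p)
  have "(\<lambda>t. g_sample pr k t $ i) = (\<lambda>t. 0)"
    by (auto simp: Inr fun_eq_iff g_sample_def vec_append_def)
  then show ?thesis by (simp add: Inr g_mean_def vec_append_def)
qed

section \<open>Averages over the agents and the saddle point\<close>

lemma gram_mean:
  "gram pr (mean_state_weighting pr) = (\<Sum>k\<in>UNIV. weights pr $ k *\<^sub>R gram pr (state_weighting pr k))"
  by (simp add: matrix_eq gram_def mean_state_weighting_def matrix_vector_mul_assoc[symmetric]
      weighted_matrix_sum_mult matrix_weighted_sum_mult del: transpose_matrix_vector)

lemma td_matrix_mean:
  "td_matrix pr (mean_state_weighting pr) = (\<Sum>k\<in>UNIV. weights pr $ k *\<^sub>R td_matrix pr (state_weighting pr k))"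
  by (simp add: matrix_eq td_matrix_def mean_state_weighting_def matrix_vector_mul_assoc[symmetric]
      weighted_matrix_sum_mult matrix_weighted_sum_mult del: transpose_matrix_vector)

lemma td_vec_mean:
  "td_vec pr (mean_state_weighting pr) = (\<Sum>k\<in>UNIV. weights pr $ k *\<^sub>R td_vec pr (state_weighting pr k))"
  by (simp add: td_vec_def mean_state_weighting_def weighted_matrix_sum_mult matrix_weighted_sum_mult
      del: transpose_matrix_vector)

text \<open>Each block is linear in the state weighting, so averaging puts the mean weighting in its
  place. The result is the linear part of the first-order conditions of the global Lagrangian, up to
  the factor \<open>eta pr\<close> and a sign.\<close>

lemma weighted_sum_G_mean:
  "(\<Sum>k\<in>UNIV. weights pr $ k *\<^sub>R (G_mean pr k *v vec_append u w)) =
    vec_append (eta pr *\<^sub>R (gram pr (mean_state_weighting pr) *v u + td_matrix pr (mean_state_weighting pr) *v w))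
      (- (transpose (td_matrix pr (mean_state_weighting pr)) *v u))"
  unfolding gram_mean td_matrix_mean transpose_weighted_sum weighted_matrix_sum_mult
  by (simp add: G_mean_def Let_def four_block_mult vec_append_linear sum_vec_append
      uminus_matrix_vector_mult scaleR_matrix_vector_assoc[symmetric] scaleR_add_right sum.distrib
      scaleR_sum_right sum_negf mult.commute del: transpose_matrix_vector)

text \<open>The lower right block is zero, so the second row alone forces \<open>u = 0\<close>; the
  first row then forces \<open>w = 0\<close>.\<close>

lemma weighted_sum_G_mean_inj:
  assumes "(\<Sum>k\<in>UNIV. weights pr $ k *\<^sub>R (G_mean pr k *v y)) = 0"
  shows "y = 0"
proof -
  obtain u w where y: "y = vec_append u w" by (rule vec_append_cases)
  let ?A = "td_matrix pr (mean_state_weighting pr)"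
  have cancel: "v = 0" if "invertible B" "B *v v = 0" for B :: "real^'m^'m" and v
    using that by (metis invertible_left_inverse matrix_left_invertible_ker)
  have "transpose ?A *v u = 0"
    using assms by (simp add: y weighted_sum_G_mean vec_append_linear del: transpose_matrix_vector)
  then have u: "u = 0"
    using cancel[of "transpose ?A" u] td_matrix_invertible by (simp add: transpose_invertible del: transpose_matrix_vector)
  then have "?A *v w = 0"
    using assms eta_pos by (simp add: y weighted_sum_G_mean vec_append_linear)
  then have "w = 0" using cancel td_matrix_invertible by blast
  with u show ?thesis by (simp add: y vec_append_linear)
qed

text \<open>The primal part of \<open>alpha_opt\<close> is 0, and \<open>w_opt\<close> solves the
  averaged system. Only the weighted sum is claimed to vanish: a single agent may have a nonzero
  residual, which is the source of the bias.\<close>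

lemma weighted_sum_optimality:
  "(\<Sum>k\<in>UNIV. weights pr $ k *\<^sub>R (G_mean pr k *v alpha_opt pr + g_mean pr k)) = 0"
proof -
  let ?D = "mean_state_weighting pr"
  have "td_matrix pr ?D *v w_opt pr = td_vec pr ?D"
    unfolding w_opt_def using td_matrix_invertible by (simp add: matrix_vector_mul_assoc matrix_inv_right)
  moreover have "(\<Sum>k\<in>UNIV. weights pr $ k *\<^sub>R g_mean pr k) = vec_append (- eta pr *\<^sub>R td_vec pr ?D) 0"
    by (simp add: g_mean_def td_vec_mean vec_append_linear sum_vec_append scaleR_sum_right mult.commute sum_negf)
  ultimately show ?thesis
    by (simp add: scaleR_add_right sum.distrib alpha_opt_def weighted_sum_G_mean vec_append_linear)
qed

end

section \<open>Mean error recursion and bias\<close>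

text \<open>The data of time \<open>j\<close> first enter iterate \<open>Suc j\<close>, so iterate
  \<open>i\<close> is a function of the past alone.\<close>

lemma gtd_iterate_dependence:
  assumes "\<And>l j. j < i \<Longrightarrow> z l j = z' l j"
  shows "gtd_iterate pr \<mu> \<alpha>0 z i k = gtd_iterate pr \<mu> \<alpha>0 z' i k"
  using assms by (induction i arbitrary: k) (simp_all add: Let_def)

context gtd_data begin

text \<open>Finitely many data points with finitely many values leave \<open>F\<close> only finitely
  many values, hence bounded. The other two claims factor \<open>F\<close> through the restricted
  data, as needed for composition with independent families.\<close>

lemma finite_dependence:
  fixes F :: "('n \<Rightarrow> nat \<Rightarrow> 's \<times> 'a \<times> 's) \<Rightarrow> 'b::{banach, second_countable_topology}"
  assumes dep: "\<And>z z'. (\<And>l j. j < i \<Longrightarrow> z l j = z' l j) \<Longrightarrow> F z = F z'"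
  shows "integrable \<Omega> (\<lambda>\<omega>. F (\<lambda>l j. Z l j \<omega>))"
    and "(\<lambda>w. F (\<lambda>l j. w (l, j))) \<in> borel_measurable (PiM (UNIV \<times> {..<i}) (\<lambda>_. count_space UNIV))"
    and "(\<lambda>\<omega>. F (\<lambda>l j. Z l j \<omega>)) =
      (\<lambda>w. F (\<lambda>l j. w (l, j))) \<circ> (\<lambda>\<omega>. restrict (\<lambda>p. (case p of (k, j) \<Rightarrow> Z k j) \<omega>) (UNIV \<times> {..<i}))"
proof -
  let ?J = "(UNIV :: 'n set) \<times> {..<i}"
  let ?H = "\<lambda>w :: 'n \<times> nat \<Rightarrow> 's \<times> 'a \<times> 's. F (\<lambda>l j. w (l, j))"
  let ?R = "\<lambda>\<omega>. restrict (\<lambda>p. (case p of (k, j) \<Rightarrow> Z k j) \<omega>) ?J"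
  \<comment> \<open>A finite product of finite discrete spaces is discrete, so measurability is
    automatic.\<close>
  have PiM: "PiM ?J (\<lambda>_. count_space (UNIV :: ('s \<times> 'a \<times> 's) set)) = count_space (PiE ?J (\<lambda>_. UNIV))"
    by (rule count_space_PiM_finite) auto
  show meas: "?H \<in> borel_measurable (PiM ?J (\<lambda>_. count_space UNIV))"
    unfolding PiM by simp
  \<comment> \<open>\<open>restrict\<close> replaces the data from time \<open>i\<close> on by
    \<open>undefined\<close>, which \<open>F\<close> ignores.\<close>
  show eq: "(\<lambda>\<omega>. F (\<lambda>l j. Z l j \<omega>)) = ?H \<circ> ?R"
    by (auto simp: fun_eq_iff intro!: dep)
  have Z_meas: "(\<lambda>\<omega>. (case p of (k, j) \<Rightarrow> Z k j) \<omega>) \<in> measurable \<Omega> (count_space UNIV)" for p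
    using data_indep by (auto simp: indep_vars_def split: prod.splits)
  have "?R \<in> measurable \<Omega> (PiM ?J (\<lambda>_. count_space UNIV))"
    by (rule measurable_restrict) (rule Z_meas)
  then have meas': "(\<lambda>\<omega>. F (\<lambda>l j. Z l j \<omega>)) \<in> borel_measurable \<Omega>"
    unfolding eq using meas by (rule measurable_comp)
  have "finite (?H ` PiE ?J (\<lambda>_. UNIV))"
    by (intro finite_imageI finite_PiE) auto
  from finite_imp_bounded[OF this] obtain B where B: "\<And>w. w \<in> PiE ?J (\<lambda>_. UNIV) \<Longrightarrow> norm (?H w) \<le> B"
    by (auto simp: bounded_iff)
  show "integrable \<Omega> (\<lambda>\<omega>. F (\<lambda>l j. Z l j \<omega>))"
  proof (rule integrable_const_bound[OF AE_I2 meas'])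
    fix \<omega>
    have "norm (?H (?R \<omega>)) \<le> B" by (rule B, subst restrict_PiE_iff) simp
    then show "norm (F (\<lambda>l j. Z l j \<omega>)) \<le> B" using fun_cong[OF eq, of \<omega>] by (simp add: o_def)
  qed
qed

text \<open>The index \<open>(k, i)\<close> lies outside the set of indices with time below
  \<open>i\<close>, so joint independence separates the new sample from the past and the expectation
  of the product factors.\<close>

lemma expectation_fresh_sample:
  fixes F :: "('n \<Rightarrow> nat \<Rightarrow> 's \<times> 'a \<times> 's) \<Rightarrow> real" and h :: "'s \<times> 'a \<times> 's \<Rightarrow> real"
  assumes dep: "\<And>z z'. (\<And>l j. j < i \<Longrightarrow> z l j = z' l j) \<Longrightarrow> F z = F z'"
  shows "integrable \<Omega> (\<lambda>\<omega>. h (Z k i \<omega>))"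
    and "expectation (\<lambda>\<omega>. h (Z k i \<omega>)) = measure_pmf.expectation (sample_pmf pr k) h"
    and "integrable \<Omega> (\<lambda>\<omega>. h (Z k i \<omega>) * F (\<lambda>l j. Z l j \<omega>))"
    and "expectation (\<lambda>\<omega>. h (Z k i \<omega>) * F (\<lambda>l j. Z l j \<omega>)) =
      measure_pmf.expectation (sample_pmf pr k) h * expectation (\<lambda>\<omega>. F (\<lambda>l j. Z l j \<omega>))"
proof -
  have Zk: "Z k i \<in> measurable \<Omega> (count_space UNIV)"
    using data_indep by (auto simp: indep_vars_def)
  show int: "integrable \<Omega> (\<lambda>\<omega>. h (Z k i \<omega>))"
    \<comment> \<open>The horizon is \<open>Suc i\<close> because the function reads the data of
      time \<open>i\<close> itself.\<close>
    by (rule finite_dependence(1)[where F = "\<lambda>z. h (z k i)" and i = "Suc i"]) simp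
  show ex: "expectation (\<lambda>\<omega>. h (Z k i \<omega>)) = measure_pmf.expectation (sample_pmf pr k) h"
    unfolding data_distr[of k i, symmetric] by (subst integral_distr[OF Zk]) auto
  let ?J = "(UNIV :: 'n set) \<times> {..<i}"
  let ?X = "\<lambda>p. case p of (k, j) \<Rightarrow> Z k j"
  have "indep_var (PiM {(k, i)} (\<lambda>_. count_space UNIV)) (\<lambda>\<omega>. restrict (\<lambda>p. ?X p \<omega>) {(k, i)})
      (PiM ?J (\<lambda>_. count_space UNIV)) (\<lambda>\<omega>. restrict (\<lambda>p. ?X p \<omega>) ?J)"
    by (rule indep_var_restrict[OF data_indep]) auto
  then have "indep_var borel ((\<lambda>w. h (w (k, i))) \<circ> (\<lambda>\<omega>. restrict (\<lambda>p. ?X p \<omega>) {(k, i)}))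
      borel ((\<lambda>w. F (\<lambda>l j. w (l, j))) \<circ> (\<lambda>\<omega>. restrict (\<lambda>p. ?X p \<omega>) ?J))"
    by (rule indep_var_compose) (auto intro!: finite_dependence(2) dep
        measurable_compose[OF measurable_component_singleton])
  moreover have "(\<lambda>w. F (\<lambda>l j. w (l, j))) \<circ> (\<lambda>\<omega>. restrict (\<lambda>p. ?X p \<omega>) ?J) = (\<lambda>\<omega>. F (\<lambda>l j. Z l j \<omega>))"
    by (rule finite_dependence(3)[OF dep, symmetric])
  moreover have "(\<lambda>w. h (w (k, i))) \<circ> (\<lambda>\<omega>. restrict (\<lambda>p. ?X p \<omega>) {(k, i)}) = (\<lambda>\<omega>. h (Z k i \<omega>))"
    by (simp add: fun_eq_iff)
  ultimately have indep: "indep_var borel (\<lambda>\<omega>. h (Z k i \<omega>)) borel (\<lambda>\<omega>. F (\<lambda>l j. Z l j \<omega>))"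
    by (simp only:)
  have intF: "integrable \<Omega> (\<lambda>\<omega>. F (\<lambda>l j. Z l j \<omega>))"
    by (rule finite_dependence(1)[OF dep])
  show "integrable \<Omega> (\<lambda>\<omega>. h (Z k i \<omega>) * F (\<lambda>l j. Z l j \<omega>))"
    by (rule indep_var_integrable[OF indep int intF])
  show "expectation (\<lambda>\<omega>. h (Z k i \<omega>) * F (\<lambda>l j. Z l j \<omega>)) =
      measure_pmf.expectation (sample_pmf pr k) h * expectation (\<lambda>\<omega>. F (\<lambda>l j. Z l j \<omega>))"
    unfolding ex[symmetric] by (rule indep_var_lebesgue_integral[OF indep int intF])
qed

section \<open>Recursion of the mean iterate and the mean error\<close>

abbreviation mean_iterate :: "real \<Rightarrow> ('n \<Rightarrow> real^('m + 'm)) \<Rightarrow> nat \<Rightarrow> 'n \<Rightarrow> real^('m + 'm)" where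
  "mean_iterate \<mu> \<alpha>0 i k \<equiv> expectation (\<lambda>\<omega>. gtd_iterate pr \<mu> \<alpha>0 (\<lambda>l j. Z l j \<omega>) i k)"

lemma mean_iterate_nth:
  "mean_iterate \<mu> \<alpha>0 i k $ q = expectation (\<lambda>\<omega>. gtd_iterate pr \<mu> \<alpha>0 (\<lambda>l j. Z l j \<omega>) i k $ q)"
  by (rule integral_bounded_linear[symmetric, OF bounded_linear_vec_nth])
    (rule finite_dependence(1)[where F = "\<lambda>z. gtd_iterate pr \<mu> \<alpha>0 z i k" and i = i], rule gtd_iterate_dependence)

text \<open>The sample of time \<open>i\<close> is independent of iterate \<open>i\<close>, so
  \<open>G_sample\<close> may be averaged separately. The argument runs over scalar entries, where
  the product rule applies.\<close>

lemma mean_iterate_Suc: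
  "mean_iterate \<mu> \<alpha>0 (Suc i) k = (\<Sum>l\<in>UNIV. comb pr $ l $ k *\<^sub>R
     (mean_iterate \<mu> \<alpha>0 i l - \<mu> *\<^sub>R (G_mean pr l *v mean_iterate \<mu> \<alpha>0 i l + g_mean pr l)))"
proof -
  define \<alpha> where "\<alpha> l q \<omega> = gtd_iterate pr \<mu> \<alpha>0 (\<lambda>l j. Z l j \<omega>) i l $ q" for l q \<omega>
  have dep: "gtd_iterate pr \<mu> \<alpha>0 z i l $ q = gtd_iterate pr \<mu> \<alpha>0 z' i l $ q"
    if "\<And>l j. j < i \<Longrightarrow> z l j = z' l j" for z z' l q
    by (simp add: gtd_iterate_dependence[OF that])
  have int: "integrable \<Omega> (\<alpha> l q)" for l q
    unfolding \<alpha>_def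
    by (rule finite_dependence(1)[where F = "\<lambda>z. gtd_iterate pr \<mu> \<alpha>0 z i l $ q", OF dep])
  have intG: "integrable \<Omega> (\<lambda>\<omega>. h (Z l i \<omega>) * \<alpha> l q \<omega>)"
    and exG: "expectation (\<lambda>\<omega>. h (Z l i \<omega>) * \<alpha> l q \<omega>) =
      measure_pmf.expectation (sample_pmf pr l) h * expectation (\<alpha> l q)" for l q h
    unfolding \<alpha>_def
    using expectation_fresh_sample(3,4)[where F = "\<lambda>z. gtd_iterate pr \<mu> \<alpha>0 z i l $ q" and h = h and k = l, OF dep]
    by auto
  \<comment> \<open>These claims concern the sample alone, so a constant serves as the function of
    the past.\<close>
  have intg: "integrable \<Omega> (\<lambda>\<omega>. h (Z l i \<omega>))"
    and exg: "expectation (\<lambda>\<omega>. h (Z l i \<omega>)) = measure_pmf.expectation (sample_pmf pr l) h" for l and h :: "'s \<times> 'a \<times> 's \<Rightarrow> real"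
    using expectation_fresh_sample(1,2)[where F = "\<lambda>_. 0" and i = i and h = h and k = l] by auto
  have G_int: "integrable \<Omega> (\<lambda>\<omega>. G_sample pr l (Z l i \<omega>) $ q $ p * \<alpha> l p \<omega>)"
    and G_ex: "expectation (\<lambda>\<omega>. G_sample pr l (Z l i \<omega>) $ q $ p * \<alpha> l p \<omega>) =
      G_mean pr l $ q $ p * expectation (\<alpha> l p)" for l q p
    using intG[of "\<lambda>t. G_sample pr l t $ q $ p" l p] exG[of "\<lambda>t. G_sample pr l t $ q $ p" l p]
    by (simp_all add: expectation_G_sample)
  have g_int: "integrable \<Omega> (\<lambda>\<omega>. g_sample pr l (Z l i \<omega>) $ q)"
    and g_ex: "expectation (\<lambda>\<omega>. g_sample pr l (Z l i \<omega>) $ q) = g_mean pr l $ q" for l q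
    using intg[of "\<lambda>t. g_sample pr l t $ q" l] exg[of "\<lambda>t. g_sample pr l t $ q" l]
    by (simp_all add: expectation_g_sample)
  have "mean_iterate \<mu> \<alpha>0 (Suc i) k $ q = (\<Sum>l\<in>UNIV. comb pr $ l $ k *\<^sub>R
     (mean_iterate \<mu> \<alpha>0 i l - \<mu> *\<^sub>R (G_mean pr l *v mean_iterate \<mu> \<alpha>0 i l + g_mean pr l))) $ q" for q
  proof -
    have "mean_iterate \<mu> \<alpha>0 (Suc i) k $ q = expectation (\<lambda>\<omega>. \<Sum>l\<in>UNIV. comb pr $ l $ k *
        (\<alpha> l q \<omega> - \<mu> * ((\<Sum>p\<in>UNIV. G_sample pr l (Z l i \<omega>) $ q $ p * \<alpha> l p \<omega>) + g_sample pr l (Z l i \<omega>) $ q)))"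
      unfolding mean_iterate_nth by (simp add: \<alpha>_def Let_def matrix_vector_mult_def)
    also have "\<dots> = (\<Sum>l\<in>UNIV. comb pr $ l $ k * (expectation (\<alpha> l q) -
        \<mu> * ((\<Sum>p\<in>UNIV. G_mean pr l $ q $ p * expectation (\<alpha> l p)) + g_mean pr l $ q)))"
      by (simp add: int G_int g_int G_ex g_ex)
    also have "\<dots> = (\<Sum>l\<in>UNIV. comb pr $ l $ k *\<^sub>R
        (mean_iterate \<mu> \<alpha>0 i l - \<mu> *\<^sub>R (G_mean pr l *v mean_iterate \<mu> \<alpha>0 i l + g_mean pr l))) $ q"
      by (simp add: matrix_vector_mult_def mean_iterate_nth \<alpha>_def[abs_def])
    finally show ?thesis .
  qed
  then show ?thesis by (simp add: vec_eq_iff)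
qed

lemma block_mean_network_error:
  "block (mean_network_error pr \<Omega> Z \<alpha>0 \<mu> i) k = alpha_opt pr - mean_iterate \<mu> \<alpha>0 i k"
proof -
  have int: "integrable \<Omega> (\<lambda>\<omega>. network_error pr \<mu> \<alpha>0 (\<lambda>l j. Z l j \<omega>) i)"
    by (rule finite_dependence(1)[where F = "\<lambda>z. network_error pr \<mu> \<alpha>0 z i" and i = i])
      (simp add: network_error_def cong: gtd_iterate_dependence)
  have int': "integrable \<Omega> (\<lambda>\<omega>. gtd_iterate pr \<mu> \<alpha>0 (\<lambda>l j. Z l j \<omega>) i k $ q)" for q
    by (rule finite_dependence(1)[where F = "\<lambda>z. gtd_iterate pr \<mu> \<alpha>0 z i k $ q" and i = i])
      (simp cong: gtd_iterate_dependence)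
  have "mean_network_error pr \<Omega> Z \<alpha>0 \<mu> i $ (k, q) = alpha_opt pr $ q - mean_iterate \<mu> \<alpha>0 i k $ q" for q
    unfolding mean_network_error_def mean_iterate_nth
      integral_bounded_linear[OF bounded_linear_vec_nth int, symmetric]
    using int' by (simp add: network_error_def col_def prob_space)
  then show ?thesis by (simp add: vec_eq_iff block_def)
qed

text \<open>Column sums equal to one make \<open>alpha_opt\<close> invariant under the combination
  step; subtracting the mean recursion from it leaves the residual of \<open>alpha_opt\<close> as
  driving term.\<close>

lemma mean_network_error_Suc:
  assumes "left_stochastic (comb pr)"
  shows "mean_network_error pr \<Omega> Z \<alpha>0 \<mu> (Suc i) =
    mean_error_matrix pr \<mu> *v mean_network_error pr \<Omega> Z \<alpha>0 \<mu> i +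
    \<mu> *\<^sub>R (transpose (network_comb pr) *v (col (G_mean pr) *v alpha_opt pr + col (g_mean pr)))"
    (is "?l = ?r")
proof -
  have block_r: "block ?r k = (\<Sum>l\<in>UNIV. comb pr $ l $ k *\<^sub>R (alpha_opt pr -
      (mean_iterate \<mu> \<alpha>0 i l - \<mu> *\<^sub>R (G_mean pr l *v mean_iterate \<mu> \<alpha>0 i l + g_mean pr l))))" for k
    by (simp add: mean_error_matrix_def network_comb_def R_mean_def matrix_vector_mul_assoc[symmetric]
        block_transpose_kronecker block_block_diag block_col_matrix block_mean_network_error
        matrix_vector_mult_diff_rdistrib scaleR_matrix_vector_assoc[symmetric] matrix_vector_mult_diff_distrib
        scaleR_sum_right sum.distrib[symmetric] algebra_simps del: transpose_matrix_vector)
  have "(\<Sum>l\<in>UNIV. comb pr $ l $ k *\<^sub>R alpha_opt pr) = alpha_opt pr" for k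
    using assms by (simp add: left_stochastic_def scaleR_sum_left[symmetric])
  then have "block ?r k = block ?l k" for k
    unfolding block_r block_mean_network_error mean_iterate_Suc
    by (simp only: scaleR_diff_right[of _ "alpha_opt pr"] sum_subtractf)
  then show ?thesis by (metis col_block ext)
qed

end

section \<open>The linear system of the bias and its size\<close>

lemma bias_system_apply:
  "bias_system pr \<mu> *v x = x - transpose (network_comb pr) *v (x - \<mu> *\<^sub>R (R_mean pr *v x))"
  by (simp add: bias_system_def mean_error_matrix_def matrix_vector_mult_diff_rdistrib
      matrix_vector_mul_assoc[symmetric] scaleR_matrix_vector_assoc[symmetric] del: transpose_matrix_vector)

theorem theorem3:
  fixes pr :: "('s::finite, 'a::finite, 'n::finite, 'm::finite) gtd_problem"
    and \<Omega> :: "'w measure"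
    and Z :: "'n \<Rightarrow> nat \<Rightarrow> 'w \<Rightarrow> 's \<times> 'a \<times> 's"
    and \<alpha>0 :: "'n \<Rightarrow> real^('m + 'm)"
  assumes "gtd_data pr \<Omega> Z"
    and "left_stochastic (comb pr)"
    and "primitive_matrix (comb pr)"
    and "perron_eigenvector (comb pr) (weights pr)"
  shows "(\<forall>\<mu>>0. mean_square_stable pr \<mu> \<longrightarrow>
            invertible (bias_system pr \<mu>) \<and>
            mean_network_error pr \<Omega> Z \<alpha>0 \<mu> \<longlonglongrightarrow> steady_state_bias pr \<mu>) \<and>
         (\<exists>K>0. \<exists>\<mu>1>0. \<forall>\<mu>. 0 < \<mu> \<and> \<mu> < \<mu>1 \<longrightarrow>
            invertible (bias_system pr \<mu>) \<and> norm (steady_state_bias pr \<mu>) \<le> K * \<mu>)"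
proof (intro conjI allI impI)
  interpret gtd_data pr \<Omega> Z by fact
  fix \<mu> :: real assume "mean_square_stable pr \<mu>"
  then have stable: "spectral_rad (mean_error_matrix pr \<mu>) < 1" by (simp add: mean_square_stable_def)
  show "invertible (bias_system pr \<mu>)"
    unfolding bias_system_def using stable by (rule invertible_one_minus_of_spectral_rad)
  show "mean_network_error pr \<Omega> Z \<alpha>0 \<mu> \<longlonglongrightarrow> steady_state_bias pr \<mu>"
    unfolding steady_state_bias_def bias_system_def
    by (rule affine_iteration_tendsto[OF stable], rule mean_network_error_Suc[OF assms(2)])
next
  interpret gtd_data pr \<Omega> Z by fact
  define b where "b = col (G_mean pr) *v alpha_opt pr + col (g_mean pr)"
  have Tb: "(\<Sum>k\<in>UNIV. weights pr $ k *\<^sub>R block b k) = 0"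
    using weighted_sum_optimality by (simp add: b_def block_col_matrix)
  obtain K \<mu>1 where K: "K > 0" "\<mu>1 > 0" and bound:
    "\<And>\<mu> x b. 0 < \<mu> \<Longrightarrow> \<mu> < \<mu>1 \<Longrightarrow> (\<Sum>k\<in>UNIV. weights pr $ k *\<^sub>R block b k) = 0 \<Longrightarrow>
       x = transpose (kronecker (comb pr) (mat 1)) *v (x - \<mu> *\<^sub>R (block_diag (G_mean pr) *v x) + \<mu> *\<^sub>R b) \<Longrightarrow>
       norm x \<le> K * \<mu> * norm b"
    using diffusion_fixed_point_bound[OF assms(2,3,4), of "G_mean pr"] weighted_sum_G_mean_inj by blast
  \<comment> \<open>The right-hand side \<open>c\<close> is kept general: \<open>c = 0\<close> gives
    invertibility, \<open>c = b\<close> the bound on the bias.\<close>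
  have solution_bound: "norm x \<le> K * \<mu> * norm c"
    if "0 < \<mu>" "\<mu> < \<mu>1" "(\<Sum>k\<in>UNIV. weights pr $ k *\<^sub>R block c k) = 0"
      "bias_system pr \<mu> *v x = \<mu> *\<^sub>R (transpose (network_comb pr) *v c)" for \<mu> x c
    using that(4) unfolding bias_system_apply network_comb_def R_mean_def
    by (intro bound[OF that(1-3)])
      (simp add: matrix_vector_right_distrib matrix_vector_mult_scaleR algebra_simps del: transpose_matrix_vector)
  have small: "invertible (bias_system pr \<mu>) \<and> norm (steady_state_bias pr \<mu>) \<le> K * norm b * \<mu>"
    if \<mu>: "0 < \<mu>" "\<mu> < \<mu>1" for \<mu>
  proof
    show inv: "invertible (bias_system pr \<mu>)"
    proof (rule invertible_of_injective)
      fix v assume "bias_system pr \<mu> *v v = 0"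
      then have "norm v \<le> K * \<mu> * norm (0 :: real^('n \<times> ('m + 'm)))"
        by (intro solution_bound[OF \<mu>]) simp_all
      then show "v = 0" by simp
    qed
    have "bias_system pr \<mu> *v steady_state_bias pr \<mu> = \<mu> *\<^sub>R (transpose (network_comb pr) *v b)"
      unfolding steady_state_bias_def b_def
      using inv by (simp add: matrix_vector_mul_assoc matrix_inv_right del: transpose_matrix_vector)
    from solution_bound[OF \<mu> Tb this]
    show "norm (steady_state_bias pr \<mu>) \<le> K * norm b * \<mu>" by (simp add: mult_ac)
  qed
  show "\<exists>K>0. \<exists>\<mu>1>0. \<forall>\<mu>. 0 < \<mu> \<and> \<mu> < \<mu>1 \<longrightarrow>
      invertible (bias_system pr \<mu>) \<and> norm (steady_state_bias pr \<mu>) \<le> K * \<mu>"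
  proof (intro exI conjI allI impI)
    \<comment> \<open>The summand 1 keeps the constant positive when \<open>b = 0\<close>.\<close>
    show "K * norm b + 1 > 0" using K by (simp add: add_nonneg_pos)
    show "\<mu>1 > 0" by fact
    fix \<mu> assume \<mu>: "0 < \<mu> \<and> \<mu> < \<mu>1"
    then show "invertible (bias_system pr \<mu>)" using small by blast
    have "norm (steady_state_bias pr \<mu>) \<le> K * norm b * \<mu>" using small \<mu> by blast
    also have "\<dots> \<le> (K * norm b + 1) * \<mu>" using \<mu> by (simp add: distrib_right)
    finally show "norm (steady_state_bias pr \<mu>) \<le> (K * norm b + 1) * \<mu>" .
  qed
qed

end
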